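(* Let $1\leq i_1<\cdots<i_s$ be a strictly increasing sequence of positive integers, and let $f(y)\in\mathbb{C}[y]$ be a polynomial with $f(0)=0$ and of degree smaller than $i_s$ ($f=0$ is allowed). Consider the ideal $$K=\prod_{k=1}^{s}\bigl((x+f(y))+\mathfrak{m}^{i_k}\bigr)\subset\mathbb{C}[x,y].$$ Then $K$ has colength $\dim_{\mathbb{C}}\mathbb{C}[x,y]/K=\sum_{k=1}^{s}\sum_{j=1}^{k}i_j$, and its Behrend number is $$\nu_{\mathbb{C}[x,y]/K}=\sum_{k=1}^{s}\sum_{j=1}^{k}i_j+\sum_{j=1}^{s-1}i_j(s-j).$$ In particular, when $i_k=k$ for all $k=1,\ldots,s$, the ideal $K_s=\prod_{k=1}^{s}\bigl((x+f(y))+\mathfrak{m}^{k}\bigr)$ has colength $\binom{s+2}{3}$, and its Behrend number is $$\nu_{\mathbb{C}[x,y]/K_s}=\frac{s(s+1)(2s+1)}{6}.$$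
   Context: $\mathfrak{m}=(x,y)\subset\mathbb{C}[x,y]$ is the maximal ideal of the origin, and $(x+f(y))$ denotes the principal ideal generated by $x+f(y)$. A fat point is a scheme $X=\operatorname{Spec}R$ of finite type over $\mathbb{C}$ with $R$ a local artinian $\mathbb{C}$-algebra. If $X\hookrightarrow\mathbb{A}^N$ is a closed embedding with ideal $I\subset A=\mathbb{C}[x_1,\ldots,x_N]$, let $C=\operatorname{Spec}\bigl(\bigoplus_{d\geq0}I^d/I^{d+1}\bigr)$ be its normal cone. The Behrend number of $X$ (also called the Behrend number of $I$, and denoted $\nu_X$, $\nu_R$ or $\nu_{A/I}$), i.e. the value of Behrend's constructible function at the unique point of $X$, is $$\nu_X=\sum_{D}\operatorname{length}_{\mathcal{O}_{C,D}}(\mathcal{O}_{C,D}),$$ the sum being over all irreducible components $D$ of $C$, where $\mathcal{O}_{C,D}$ is the local ring of $C$ at the generic point of $D$. This does not depend on the chosen embedding. *)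

theory Defs
  imports
    "HOL-Algebra.Algebra"
    "HOL-Algebra.Algebraic_Closure_Type"
    "HOL-Analysis.Abstract_Topology"
    "HOL-Library.Extended_Nat"
begin

section \<open>Spectrum and irreducible components\<close>

definition spec :: "('a, 'b) ring_scheme \<Rightarrow> 'a set set"
  where "spec R = {P. primeideal P R}"

definition vanishing_locus :: "('a, 'b) ring_scheme \<Rightarrow> 'a set \<Rightarrow> 'a set set"
  where "vanishing_locus R E = {P \<in> spec R. E \<subseteq> P}"

definition zariski_topology :: "('a, 'b) ring_scheme \<Rightarrow> 'a set topology"
  where "zariski_topology R =
    topology (\<lambda>U. \<exists>E. E \<subseteq> carrier R \<and> U = spec R - vanishing_locus R E)"

lemma istopology_zariski:
  "istopology (\<lambda>U. \<exists>E. E \<subseteq> carrier R \<and> U = spec R - vanishing_locus R E)"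
  unfolding istopology_def
proof (intro conjI allI impI)
  fix U V
  assume "\<exists>E. E \<subseteq> carrier R \<and> U = spec R - vanishing_locus R E"
    and "\<exists>E. E \<subseteq> carrier R \<and> V = spec R - vanishing_locus R E"
  then obtain E F where E: "E \<subseteq> carrier R" "U = spec R - vanishing_locus R E"
    and F: "F \<subseteq> carrier R" "V = spec R - vanishing_locus R F"
    by blast
  let ?M = "{a \<otimes>\<^bsub>R\<^esub> b | a b. a \<in> E \<and> b \<in> F}"
  have key: "?M \<subseteq> P \<longleftrightarrow> E \<subseteq> P \<or> F \<subseteq> P" if P: "primeideal P R" for P
  proof -
    interpret primeideal P R by (rule P)
    show ?thesis
    proof
      assume M: "?M \<subseteq> P"
      show "E \<subseteq> P \<or> F \<subseteq> P"
      proof (rule ccontr)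
        assume "\<not> (E \<subseteq> P \<or> F \<subseteq> P)"
        then obtain a b where ab: "a \<in> E" "a \<notin> P" "b \<in> F" "b \<notin> P" by blast
        with M have "a \<otimes>\<^bsub>R\<^esub> b \<in> P" by blast
        with ab E(1) F(1) I_prime show False by blast
      qed
    next
      assume "E \<subseteq> P \<or> F \<subseteq> P"
      then show "?M \<subseteq> P" using E(1) F(1) I_l_closed I_r_closed by blast
    qed
  qed
  show "\<exists>E. E \<subseteq> carrier R \<and> U \<inter> V = spec R - vanishing_locus R E"
  proof (cases "spec R = {}")
    case True
    then show ?thesis using E by blast
  next
    case False
    then obtain P where "primeideal P R" by (auto simp: spec_def)
    then interpret primeideal P R .
    have "?M \<subseteq> carrier R" using E(1) F(1) by blast
    moreover have "U \<inter> V = spec R - vanishing_locus R ?M"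
      using key unfolding E(2) F(2) vanishing_locus_def spec_def by blast
    ultimately show ?thesis by blast
  qed
next
  fix \<U>
  assume "\<forall>U\<in>\<U>. \<exists>E. E \<subseteq> carrier R \<and> U = spec R - vanishing_locus R E"
  then obtain e where e: "\<And>U. U \<in> \<U> \<Longrightarrow> e U \<subseteq> carrier R \<and> U = spec R - vanishing_locus R (e U)"
    by metis
  have "\<Union>\<U> = spec R - vanishing_locus R (\<Union>U\<in>\<U>. e U)"
  proof (rule Set.set_eqI)
    fix P
    have "P \<in> \<Union>\<U> \<longleftrightarrow> (\<exists>U\<in>\<U>. P \<in> spec R - vanishing_locus R (e U))"
      using e by blast
    then show "P \<in> \<Union>\<U> \<longleftrightarrow> P \<in> spec R - vanishing_locus R (\<Union>U\<in>\<U>. e U)"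
      by (auto simp: vanishing_locus_def)
  qed
  with e show "\<exists>E. E \<subseteq> carrier R \<and> \<Union>\<U> = spec R - vanishing_locus R E"
    by (intro exI[of _ "\<Union>U\<in>\<U>. e U"]) auto
qed

definition irreducible_in :: "'a topology \<Rightarrow> 'a set \<Rightarrow> bool"
  where "irreducible_in T S \<longleftrightarrow> S \<subseteq> topspace T \<and> S \<noteq> {} \<and>
    (\<forall>A B. closedin T A \<and> closedin T B \<and> S \<subseteq> A \<union> B \<longrightarrow> S \<subseteq> A \<or> S \<subseteq> B)"

definition irreducible_components :: "'a topology \<Rightarrow> 'a set set"
  where "irreducible_components T =
    {D. irreducible_in T D \<and> (\<forall>S. irreducible_in T S \<and> D \<subseteq> S \<longrightarrow> S = D)}"

definition generic_point :: "'a topology \<Rightarrow> 'a set \<Rightarrow> 'a"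
  where "generic_point T D = (THE \<xi>. \<xi> \<in> D \<and> Abstract_Topology.closure_of T {\<xi>} = D)"


section \<open>Local rings and length\<close>

definition fraction_rel :: "('a, 'b) ring_scheme \<Rightarrow> 'a set \<Rightarrow> (('a \<times> 'a) \<times> ('a \<times> 'a)) set"
  where "fraction_rel R P = {((a, s), (b, t)).
    a \<in> carrier R \<and> b \<in> carrier R \<and> s \<in> carrier R - P \<and> t \<in> carrier R - P \<and>
    (\<exists>u \<in> carrier R - P. u \<otimes>\<^bsub>R\<^esub> (a \<otimes>\<^bsub>R\<^esub> t \<ominus>\<^bsub>R\<^esub> b \<otimes>\<^bsub>R\<^esub> s) = \<zero>\<^bsub>R\<^esub>)}"

definition fraction :: "('a, 'b) ring_scheme \<Rightarrow> 'a set \<Rightarrow> 'a \<Rightarrow> 'a \<Rightarrow> ('a \<times> 'a) set"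
  where "fraction R P a s = fraction_rel R P `` {(a, s)}"

text \<open>The localization of \<open>R\<close> at the complement of a prime ideal \<open>P\<close>. The operations are
  independent of the representatives, so each of the unions below is a single fraction.\<close>

definition localization :: "('a, 'b) ring_scheme \<Rightarrow> 'a set \<Rightarrow> ('a \<times> 'a) set ring"
  where "localization R P =
    \<lparr>carrier = (carrier R \<times> (carrier R - P)) // fraction_rel R P,
     monoid.mult = (\<lambda>U V. \<Union>(a, s)\<in>U. \<Union>(b, t)\<in>V. fraction R P (a \<otimes>\<^bsub>R\<^esub> b) (s \<otimes>\<^bsub>R\<^esub> t)),
     one = fraction R P \<one>\<^bsub>R\<^esub> \<one>\<^bsub>R\<^esub>,
     ring.zero = fraction R P \<zero>\<^bsub>R\<^esub> \<one>\<^bsub>R\<^esub>,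
     add = (\<lambda>U V. \<Union>(a, s)\<in>U. \<Union>(b, t)\<in>V.
       fraction R P (a \<otimes>\<^bsub>R\<^esub> t \<oplus>\<^bsub>R\<^esub> b \<otimes>\<^bsub>R\<^esub> s) (s \<otimes>\<^bsub>R\<^esub> t))\<rparr>"

text \<open>The length of a commutative ring as a module over itself: its submodules are its ideals.\<close>

definition ring_length :: "('a, 'b) ring_scheme \<Rightarrow> enat"
  where "ring_length R = Sup {enat n | n.
    \<exists>J :: nat \<Rightarrow> 'a set. (\<forall>k\<le>n. ideal (J k) R) \<and> (\<forall>k<n. J k \<subset> J (Suc k))}"


section \<open>Normal cone and Behrend number\<close>

abbreviation ideal_power :: "('a, 'b) ring_scheme \<Rightarrow> 'a set \<Rightarrow> nat \<Rightarrow> 'a set"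
  where "ideal_power R I d \<equiv> I [^]\<^bsub>ideals_set R\<^esub> d"

text \<open>The associated graded ring \<open>\<Oplus>\<^sub>d I\<^sup>d / I\<^sup>d\<^sup>+\<^sup>1\<close>. An element is a finitely supported sequence whose
  entry in degree \<open>d\<close> is a coset of \<open>I\<^sup>d\<^sup>+\<^sup>1\<close> with a representative in \<open>I\<^sup>d\<close>. The product of the classes
  of \<open>a \<in> I\<^sup>i\<close> and \<open>b \<in> I\<^sup>j\<close> is the class of \<open>a b\<close> modulo \<open>I\<^sup>i\<^sup>+\<^sup>j\<^sup>+\<^sup>1\<close>, which is what
  \<^const>\<open>rcoset_mult\<close> computes on the two cosets.\<close>

definition assoc_graded :: "('a, 'b) ring_scheme \<Rightarrow> 'a set \<Rightarrow> (nat \<Rightarrow> 'a set) ring"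
  where "assoc_graded R I =
    \<lparr>carrier = {g. (\<forall>d. \<exists>a \<in> ideal_power R I d. g d = ideal_power R I (Suc d) +>\<^bsub>R\<^esub> a) \<and>
       finite {d. g d \<noteq> ideal_power R I (Suc d)}},
     monoid.mult = (\<lambda>g h d. \<Oplus>\<^bsub>R Quot ideal_power R I (Suc d)\<^esub>i\<in>{..d}.
       rcoset_mult R (ideal_power R I (Suc d)) (g i) (h (d - i))),
     one = (\<lambda>d. if d = 0 then ideal_power R I (Suc 0) +>\<^bsub>R\<^esub> \<one>\<^bsub>R\<^esub> else ideal_power R I (Suc d)),
     ring.zero = (\<lambda>d. ideal_power R I (Suc d)),
     add = (\<lambda>g h d. g d <+>\<^bsub>R\<^esub> h d)\<rparr>"

text \<open>The point set of the normal cone of the closed subscheme of \<open>Spec R\<close> defined by \<open>I\<close>.\<close>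

definition normal_cone :: "('a, 'b) ring_scheme \<Rightarrow> 'a set \<Rightarrow> (nat \<Rightarrow> 'a set) set topology"
  where "normal_cone R I = zariski_topology (assoc_graded R I)"

text \<open>For noetherian \<open>R\<close> there are finitely many components. In general the sum is \<open>0\<close> by
  convention when there are infinitely many, so a nonzero value entails finiteness.\<close>

definition behrend_number :: "('a, 'b) ring_scheme \<Rightarrow> 'a set \<Rightarrow> enat"
  where "behrend_number R I = (\<Sum>D \<in> irreducible_components (normal_cone R I).
    ring_length (localization (assoc_graded R I) (generic_point (normal_cone R I) D)))"


section \<open>The plane\<close>

text \<open>\<open>\<complex>[x, y]\<close> is modelled as \<open>\<complex>[y][x]\<close>: the outer variable is \<open>x\<close>, the inner one is \<open>y\<close>, so that
  a polynomial \<open>f\<close> in \<open>y\<close> is \<open>[:f:]\<close> and \<open>x + f(y)\<close> is \<open>[:0, 1:] + [:f:]\<close>.\<close>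

abbreviation plane_ring :: "complex poly poly ring"
  where "plane_ring \<equiv> ring_of_type_algebra"

definition plane_x :: "complex poly poly"
  where "plane_x = [:0, 1:]"

definition plane_y :: "complex poly poly"
  where "plane_y = [:[:0, 1:]:]"

definition origin_ideal :: "complex poly poly set"
  where "origin_ideal = Idl\<^bsub>plane_ring\<^esub> {plane_x, plane_y}"

definition curve_ideal_product :: "complex poly \<Rightarrow> (nat \<Rightarrow> nat) \<Rightarrow> nat \<Rightarrow> complex poly poly set"
  where "curve_ideal_product f i s =
    (\<Otimes>\<^bsub>ideals_set plane_ring\<^esub>k\<in>{1..s}.
      PIdl\<^bsub>plane_ring\<^esub> (plane_x + [:f:]) <+>\<^bsub>plane_ring\<^esub> ideal_power plane_ring origin_ideal (i k))"

text \<open>\<open>dim\<^sub>\<complex> \<complex>[x, y] / I = n\<close>, where \<open>\<complex>\<close> acts on the quotient through the classes of the constants.\<close>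

definition has_colength :: "complex poly poly set \<Rightarrow> nat \<Rightarrow> bool"
  where "has_colength I n \<longleftrightarrow>
    ring.dimension (plane_ring Quot I) n
      (range (\<lambda>c :: complex. I +>\<^bsub>plane_ring\<^esub> [:[:c:]:]))
      (carrier (plane_ring Quot I))"

end

theory Submission
  imports Defs
begin

text \<open>
  Put \<open>X = x + f(y)\<close>, called \<open>curve\<close> below. Since \<open>f(0) = 0\<close>, the functions \<open>X\<close> and \<open>y\<close> are
  coordinates of the plane that generate the ideal of the origin, so the \<open>k\<close>-th factor of the product
  ideal \<open>K\<close> is \<open>(X, y^i\<^sub>k)\<close>, and \<open>K\<close> is a monomial ideal in \<open>X\<close> and \<open>y\<close>.
  As the exponents increase, its Newton polygon is convex with one edge for each \<open>j\<close>, joining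
  \<open>X^(s-j+1) y^(i\<^sub>1 + \<dots> + i\<^sub>j\<^sub>-\<^sub>1)\<close> to \<open>X^(s-j) y^(i\<^sub>1 + \<dots> + i\<^sub>j)\<close>. On that edge the monomial valuation \<open>w\<^sub>j\<close> with
  \<open>w\<^sub>j(X) = i\<^sub>j\<close> and \<open>w\<^sub>j(y) = 1\<close> takes its minimum over \<open>K\<close>, which is
  \<open>v\<^sub>j = \<Sum>\<^sub>k min(i\<^sub>j, i\<^sub>k) = i\<^sub>1 + \<dots> + i\<^sub>j + i\<^sub>j (s - j)\<close>.

  Everything rests on one description of the powers (\<open>power_eq_valuations\<close>):
  \<open>K^d = {p. w\<^sub>j(p) \<ge> d v\<^sub>j for all j}\<close>. One inclusion says that valuations are multiplicative; for the other
  it suffices to treat a monomial, and a monomial in the right-hand side is divisible by a product of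
  generators, found by always serving the factor with the largest exponent first
  (\<open>monomial_factorization\<close>). For \<open>d = 1\<close> this gives the colength: a basis of the quotient is
  formed by the monomials under the staircase, and the column \<open>X^a\<close> contains \<open>i\<^sub>1 + \<dots> + i\<^sub>s\<^sub>-\<^sub>a\<close> of them.

  For the Behrend number, call \<open>w\<^sub>j(a) - d v\<^sub>j\<close> the \<open>j\<close>-th excess of an element \<open>a \<in> K^d\<close>, viewed in degree
  \<open>d\<close> of the associated graded ring. Excess adds up under multiplication, so the elements of
  positive \<open>j\<close>-th excess form a prime \<open>P\<^sub>j\<close>. An element whose \<open>k\<close>-th excess is at least \<open>v\<^sub>k\<close> for all \<open>k\<close>
  lies in \<open>K^(d+1)\<close> and hence vanishes; thus an element of which every excess is positive is nilpotent, and
  every prime contains some \<open>P\<^sub>j\<close>. The product of the two ends of the \<open>j\<close>-th edge, in degree 2, has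
  \<open>j\<close>-th excess zero and all other excesses positive. It shows that the \<open>P\<^sub>j\<close> are incomparable, so that
  they are the generic points of the components of the normal cone. It is moreover invertible in
  the local ring at \<open>P\<^sub>j\<close>, and multiplying by its powers makes the other excesses irrelevant there.
  So \<open>y\<close>, whose \<open>j\<close>-th excess is 1, generates the maximal ideal of that local ring, and
  \<open>y^n = 0\<close> there exactly when \<open>n \<ge> v\<^sub>j\<close>. The length is therefore \<open>v\<^sub>j\<close>, and the Behrend number is
  \<open>\<Sum>\<^sub>j v\<^sub>j\<close> (\<open>behrend_number_valuation_ideal\<close>).
\<close>

section \<open>Irreducible components of a spectrum\<close>

lemma topspace_zariski [simp]: "topspace (zariski_topology R) = spec R"
proof -
  have op: "openin (zariski_topology R) U \<longleftrightarrow>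
      (\<exists>E. E \<subseteq> carrier R \<and> U = spec R - vanishing_locus R E)" for U
    unfolding zariski_topology_def topology_inverse'[OF istopology_zariski] ..
  show ?thesis
  proof (cases "spec R = {}")
    case True
    then show ?thesis unfolding topspace_def by (auto simp: op)
  next
    case False
    then obtain P where "primeideal P R" by (auto simp: spec_def)
    then interpret primeideal P R .
    have "vanishing_locus R (carrier R) = {}"
    proof -
      have "\<not> carrier R \<subseteq> Q" if "primeideal Q R" for Q
      proof -
        interpret Q: primeideal Q R by (rule that)
        show ?thesis using Q.I_notcarr Q.a_subset by blast
      qed
      then show ?thesis by (auto simp: vanishing_locus_def spec_def)
    qed
    then have "openin (zariski_topology R) (spec R)" unfolding op by blast
    moreover have "openin (zariski_topology R) U \<Longrightarrow> U \<subseteq> spec R" for U unfolding op by blast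
    ultimately show ?thesis unfolding topspace_def by blast
  qed
qed

lemma closedin_zariski:
  "closedin (zariski_topology R) A \<longleftrightarrow> (\<exists>E. E \<subseteq> carrier R \<and> A = vanishing_locus R E)"
proof -
  have sub: "vanishing_locus R E \<subseteq> spec R" for E by (auto simp: vanishing_locus_def)
  show ?thesis
    unfolding closedin_def topspace_zariski
    unfolding zariski_topology_def topology_inverse'[OF istopology_zariski]
    using sub by (metis double_diff order_refl Diff_subset)
qed

lemma prime_ideal_subset_carrier: "P \<in> spec R \<Longrightarrow> P \<subseteq> carrier R"
  unfolding spec_def using primeideal.axioms(1) ideal.axioms(1) additive_subgroup.a_subset by blast

lemma closedin_vanishing_locus: "P \<in> spec R \<Longrightarrow> closedin (zariski_topology R) (vanishing_locus R P)"
  unfolding closedin_zariski using prime_ideal_subset_carrier by blast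

text \<open>A closed set that contains the point \<open>P\<close> contains everything that specializes from it.\<close>

lemma irreducible_vanishing_locus:
  assumes "P \<in> spec R"
  shows "irreducible_in (zariski_topology R) (vanishing_locus R P)"
  unfolding irreducible_in_def
proof (intro conjI allI impI)
  have P: "P \<in> vanishing_locus R P" using assms by (simp add: vanishing_locus_def)
  then show "vanishing_locus R P \<noteq> {}" by blast
  show "vanishing_locus R P \<subseteq> topspace (zariski_topology R)" by (auto simp: vanishing_locus_def)
  fix A B assume "closedin (zariski_topology R) A \<and> closedin (zariski_topology R) B \<and>
    vanishing_locus R P \<subseteq> A \<union> B"
  with P obtain C where "P \<in> C" "closedin (zariski_topology R) C" "C = A \<or> C = B" by blast
  then have "vanishing_locus R P \<subseteq> C"
    by (auto simp: closedin_zariski vanishing_locus_def)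
  with \<open>C = A \<or> C = B\<close> show "vanishing_locus R P \<subseteq> A \<or> vanishing_locus R P \<subseteq> B" by blast
qed

lemma irreducible_in_finite_cover:
  assumes "irreducible_in T S" "finite \<C>" "\<And>C. C \<in> \<C> \<Longrightarrow> closedin T C" "S \<subseteq> \<Union>\<C>"
  shows "\<exists>C\<in>\<C>. S \<subseteq> C"
  using assms(2-4)
proof (induction \<C> rule: finite_induct)
  case empty
  with assms(1) show ?case by (simp add: irreducible_in_def)
next
  case (insert C \<C>)
  have "closedin T C" "closedin T (\<Union>\<C>)" using insert by (auto intro!: closedin_Union)
  with insert.prems(2) assms(1) have "S \<subseteq> C \<or> S \<subseteq> \<Union>\<C>" unfolding irreducible_in_def by auto
  with insert show ?case by auto
qed

lemma closure_of_prime: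
  assumes "P \<in> spec R"
  shows "zariski_topology R closure_of {P} = vanishing_locus R P"
proof (rule closure_of_unique)
  show "{P} \<subseteq> vanishing_locus R P" using assms by (simp add: vanishing_locus_def)
  show "closedin (zariski_topology R) (vanishing_locus R P)" by (rule closedin_vanishing_locus[OF assms])
  show "vanishing_locus R P \<subseteq> T'" if "{P} \<subseteq> T'" "closedin (zariski_topology R) T'" for T'
    using that by (auto simp: closedin_zariski vanishing_locus_def)
qed

lemma generic_point_vanishing_locus:
  assumes "P \<in> spec R"
  shows "generic_point (zariski_topology R) (vanishing_locus R P) = P"
  unfolding generic_point_def
proof (rule the_equality)
  show "P \<in> vanishing_locus R P \<and> zariski_topology R closure_of {P} = vanishing_locus R P"
    using assms closure_of_prime by (simp add: vanishing_locus_def)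
  fix Q assume Q: "Q \<in> vanishing_locus R P \<and> zariski_topology R closure_of {Q} = vanishing_locus R P"
  then have "Q \<in> spec R" by (simp add: vanishing_locus_def)
  with Q have "vanishing_locus R Q = vanishing_locus R P" by (simp add: closure_of_prime)
  with Q assms have "P \<in> vanishing_locus R Q" "Q \<in> vanishing_locus R P"
    by (auto simp: vanishing_locus_def)
  then show "Q = P" by (auto simp: vanishing_locus_def)
qed

text \<open>Every irreducible set lies in one of the finitely many closed sets \<open>V(P)\<close> that cover the spectrum,
  and these are themselves irreducible, so they are the maximal ones as soon as no \<open>P\<close> contains
  another.\<close>

lemma irreducible_components_zariski:
  assumes fin: "finite Ps" and Ps: "Ps \<subseteq> spec R"
    and cover: "\<And>Q. Q \<in> spec R \<Longrightarrow> \<exists>P\<in>Ps. P \<subseteq> Q"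
    and incomparable: "\<And>P Q. \<lbrakk>P \<in> Ps; Q \<in> Ps; P \<subseteq> Q\<rbrakk> \<Longrightarrow> P = Q"
  shows "irreducible_components (zariski_topology R) = vanishing_locus R ` Ps"
proof -
  have sub: "\<exists>P\<in>Ps. S \<subseteq> vanishing_locus R P" if S: "irreducible_in (zariski_topology R) S" for S
  proof -
    have "S \<subseteq> spec R" using S by (simp add: irreducible_in_def)
    with cover have "S \<subseteq> \<Union>(vanishing_locus R ` Ps)"
      unfolding vanishing_locus_def by auto
    moreover have "closedin (zariski_topology R) C" if "C \<in> vanishing_locus R ` Ps" for C
      using that Ps closedin_vanishing_locus by blast
    ultimately show ?thesis
      using irreducible_in_finite_cover[OF S, of "vanishing_locus R ` Ps"] fin by blast
  qed
  show ?thesis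
  proof (intro equalityI subsetI)
    fix D assume "D \<in> irreducible_components (zariski_topology R)"
    then have D: "irreducible_in (zariski_topology R) D"
      "\<And>S. irreducible_in (zariski_topology R) S \<Longrightarrow> D \<subseteq> S \<Longrightarrow> S = D"
      by (auto simp: irreducible_components_def)
    from sub[OF D(1)] obtain P where "P \<in> Ps" "D \<subseteq> vanishing_locus R P" by blast
    with D(2) Ps irreducible_vanishing_locus show "D \<in> vanishing_locus R ` Ps" by blast
  next
    fix D assume "D \<in> vanishing_locus R ` Ps"
    then obtain P where P: "P \<in> Ps" "D = vanishing_locus R P" by blast
    have "S = D" if S: "irreducible_in (zariski_topology R) S" "D \<subseteq> S" for S
    proof -
      obtain Q where Q: "Q \<in> Ps" "S \<subseteq> vanishing_locus R Q" using sub[OF S(1)] by blast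
      with P S(2) Ps have "P \<in> vanishing_locus R Q" by (auto simp: vanishing_locus_def)
      with P Q incomparable have "Q = P" by (auto simp: vanishing_locus_def)
      with P Q S(2) show ?thesis by blast
    qed
    with P Ps irreducible_vanishing_locus show "D \<in> irreducible_components (zariski_topology R)"
      by (auto simp: irreducible_components_def)
  qed
qed

section \<open>Localization at a prime ideal\<close>

context primeideal
begin

lemma outside_closed:
  assumes "s \<in> carrier R - I" "t \<in> carrier R - I"
  shows "s \<otimes> t \<in> carrier R - I"
  using assms I_prime by auto

lemma one_outside: "\<one> \<in> carrier R - I"
  using I_notcarr one_imp_carrier by auto

text \<open>With zero divisors present, transitivity needs the extra denominator \<open>u\<close> in the definition of the
  relation: the witnesses of the two equalities and the middle denominator are multiplied.\<close>

lemma equiv_fraction_rel: "equiv (carrier R \<times> (carrier R - I)) (fraction_rel R I)"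
proof (rule equivI)
  show "fraction_rel R I \<subseteq> (carrier R \<times> (carrier R - I)) \<times> carrier R \<times> (carrier R - I)"
    by (auto simp: fraction_rel_def)
  show "refl_on (carrier R \<times> (carrier R - I)) (fraction_rel R I)"
    using one_outside by (auto simp: refl_on_def fraction_rel_def r_neg minus_eq)
  show "sym (fraction_rel R I)"
  proof (rule symI)
    fix x y assume "(x, y) \<in> fraction_rel R I"
    then obtain a s b t u where x: "x = (a, s)" "y = (b, t)"
      and car: "a \<in> carrier R" "b \<in> carrier R" "s \<in> carrier R - I" "t \<in> carrier R - I"
        "u \<in> carrier R - I" and eq: "u \<otimes> (a \<otimes> t \<ominus> b \<otimes> s) = \<zero>"
      by (auto simp: fraction_rel_def)
    have "u \<otimes> (b \<otimes> s \<ominus> a \<otimes> t) = \<ominus> (u \<otimes> (a \<otimes> t \<ominus> b \<otimes> s))"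
      using car by (simp, algebra)
    with x car eq show "(y, x) \<in> fraction_rel R I"
      by (auto simp: fraction_rel_def intro!: bexI[of _ u])
  qed
  show "trans (fraction_rel R I)"
  proof (rule transI)
    fix x y z assume "(x, y) \<in> fraction_rel R I" and "(y, z) \<in> fraction_rel R I"
    then obtain a s b t u c r w where x: "x = (a, s)" "z = (c, r)"
      and car: "a \<in> carrier R" "b \<in> carrier R" "c \<in> carrier R" "s \<in> carrier R - I"
        "t \<in> carrier R - I" "r \<in> carrier R - I" "u \<in> carrier R - I" "w \<in> carrier R - I"
      and eq: "u \<otimes> (a \<otimes> t \<ominus> b \<otimes> s) = \<zero>" "w \<otimes> (b \<otimes> r \<ominus> c \<otimes> t) = \<zero>"
      by (auto simp: fraction_rel_def)
    have "(u \<otimes> w \<otimes> t) \<otimes> (a \<otimes> r \<ominus> c \<otimes> s) =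
        (w \<otimes> r) \<otimes> (u \<otimes> (a \<otimes> t \<ominus> b \<otimes> s)) \<oplus> (u \<otimes> s) \<otimes> (w \<otimes> (b \<otimes> r \<ominus> c \<otimes> t))"
      using car by (simp, algebra)
    also have "\<dots> = \<zero>"
      using car by (simp add: eq)
    finally show "(x, z) \<in> fraction_rel R I"
      using x car outside_closed by (auto simp: fraction_rel_def intro!: bexI[of _ "u \<otimes> w \<otimes> t"])
  qed
qed

lemma fraction_eq_iff:
  assumes "a \<in> carrier R" "b \<in> carrier R" "s \<in> carrier R - I" "t \<in> carrier R - I"
  shows "fraction R I a s = fraction R I b t \<longleftrightarrow>
    (\<exists>u \<in> carrier R - I. u \<otimes> (a \<otimes> t \<ominus> b \<otimes> s) = \<zero>)"
proof -
  have "fraction R I a s = fraction R I b t \<longleftrightarrow> ((a, s), (b, t)) \<in> fraction_rel R I"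
    unfolding fraction_def by (rule eq_equiv_class_iff[OF equiv_fraction_rel]) (use assms in auto)
  also have "\<dots> \<longleftrightarrow> (\<exists>u \<in> carrier R - I. u \<otimes> (a \<otimes> t \<ominus> b \<otimes> s) = \<zero>)"
    using assms by (auto simp: fraction_rel_def)
  finally show ?thesis .
qed

lemma fraction_eqI:
  assumes "a \<in> carrier R" "b \<in> carrier R" "s \<in> carrier R - I" "t \<in> carrier R - I"
    and "a \<otimes> t = b \<otimes> s"
  shows "fraction R I a s = fraction R I b t"
  unfolding fraction_eq_iff[OF assms(1-4)] using assms one_outside
  by (intro bexI[of _ \<one>]) (auto simp: r_neg minus_eq)

lemma mem_fraction:
  assumes "x \<in> fraction R I a s" and "a \<in> carrier R" "s \<in> carrier R - I"
  obtains b t where "x = (b, t)" "b \<in> carrier R" "t \<in> carrier R - I"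
    "fraction R I b t = fraction R I a s"
proof -
  obtain b t where x: "x = (b, t)" by (cases x)
  with assms have rel: "((a, s), (b, t)) \<in> fraction_rel R I"
    by (auto simp: fraction_def)
  then have "b \<in> carrier R" "t \<in> carrier R - I"
    by (auto simp: fraction_rel_def)
  moreover have "fraction R I b t = fraction R I a s"
    unfolding fraction_def using equiv_class_eq[OF equiv_fraction_rel rel] by simp
  ultimately show ?thesis using that x by blast
qed

lemma fraction_self:
  assumes "a \<in> carrier R" "s \<in> carrier R - I"
  shows "(a, s) \<in> fraction R I a s"
  unfolding fraction_def using equiv_class_self[OF equiv_fraction_rel] assms by auto

text \<open>The operations of the localization are unions over all representatives. A function of
  representatives that does not depend on their choice makes such a union collapse to one value.\<close>

lemma fraction_combine:
  assumes "a \<in> carrier R" "s \<in> carrier R - I" "b \<in> carrier R" "t \<in> carrier R - I"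
    and "\<And>a' s' b' t'. \<lbrakk>a' \<in> carrier R; s' \<in> carrier R - I; b' \<in> carrier R; t' \<in> carrier R - I;
      fraction R I a' s' = fraction R I a s; fraction R I b' t' = fraction R I b t\<rbrakk> \<Longrightarrow>
      h a' s' b' t' = h a s b t"
  shows "(\<Union>(a', s') \<in> fraction R I a s. \<Union>(b', t') \<in> fraction R I b t. h a' s' b' t') = h a s b t"
proof (rule UN_constant_eq[OF fraction_self[OF assms(1,2)]], rule ballI)
  fix x assume "x \<in> fraction R I a s"
  then obtain a' s' where x: "x = (a', s')" "a' \<in> carrier R" "s' \<in> carrier R - I"
    "fraction R I a' s' = fraction R I a s"
    by (rule mem_fraction[OF _ assms(1,2)])
  have "(case y of (b', t') \<Rightarrow> h a' s' b' t') = h a s b t" if "y \<in> fraction R I b t" for y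
    by (rule mem_fraction[OF that assms(3,4)]) (use x assms(5) in simp)
  then show "(case x of (a', s') \<Rightarrow> \<Union>(b', t') \<in> fraction R I b t. h a' s' b' t') = h a s b t"
    unfolding x(1) prod.case by (intro UN_constant_eq[OF fraction_self[OF assms(3,4)]] ballI)
qed

lemma fraction_mult:
  assumes "a \<in> carrier R" "s \<in> carrier R - I" "b \<in> carrier R" "t \<in> carrier R - I"
  shows "fraction R I a s \<otimes>\<^bsub>localization R I\<^esub> fraction R I b t = fraction R I (a \<otimes> b) (s \<otimes> t)"
proof -
  have "fraction R I (a' \<otimes> b') (s' \<otimes> t') = fraction R I (a \<otimes> b) (s \<otimes> t)"
    if car: "a' \<in> carrier R" "s' \<in> carrier R - I" "b' \<in> carrier R" "t' \<in> carrier R - I"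
      and eqs: "fraction R I a' s' = fraction R I a s" "fraction R I b' t' = fraction R I b t"
    for a' s' b' t'
  proof -
    from eqs car assms obtain u w where uw: "u \<in> carrier R - I" "w \<in> carrier R - I"
      and eq: "u \<otimes> (a' \<otimes> s \<ominus> a \<otimes> s') = \<zero>" "w \<otimes> (b' \<otimes> t \<ominus> b \<otimes> t') = \<zero>"
      by (auto simp: fraction_eq_iff)
    have "(u \<otimes> w) \<otimes> ((a' \<otimes> b') \<otimes> (s \<otimes> t) \<ominus> (a \<otimes> b) \<otimes> (s' \<otimes> t')) =
      (w \<otimes> b' \<otimes> t) \<otimes> (u \<otimes> (a' \<otimes> s \<ominus> a \<otimes> s')) \<oplus> (u \<otimes> a \<otimes> s') \<otimes> (w \<otimes> (b' \<otimes> t \<ominus> b \<otimes> t'))"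
      using car assms uw by (simp, algebra)
    also have "\<dots> = \<zero>"
      unfolding eq using car assms uw by simp
    finally show ?thesis
      using car assms outside_closed uw
      by (subst fraction_eq_iff) (auto intro!: bexI[of _ "u \<otimes> w"])
  qed
  then show ?thesis
    unfolding localization_def monoid.simps
    by (subst fraction_combine[OF assms]) auto
qed

lemma fraction_add:
  assumes "a \<in> carrier R" "s \<in> carrier R - I" "b \<in> carrier R" "t \<in> carrier R - I"
  shows "fraction R I a s \<oplus>\<^bsub>localization R I\<^esub> fraction R I b t =
    fraction R I (a \<otimes> t \<oplus> b \<otimes> s) (s \<otimes> t)"
proof -
  have "fraction R I (a' \<otimes> t' \<oplus> b' \<otimes> s') (s' \<otimes> t') = fraction R I (a \<otimes> t \<oplus> b \<otimes> s) (s \<otimes> t)"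
    if car: "a' \<in> carrier R" "s' \<in> carrier R - I" "b' \<in> carrier R" "t' \<in> carrier R - I"
      and eqs: "fraction R I a' s' = fraction R I a s" "fraction R I b' t' = fraction R I b t"
    for a' s' b' t'
  proof -
    from eqs car assms obtain u w where uw: "u \<in> carrier R - I" "w \<in> carrier R - I"
      and eq: "u \<otimes> (a' \<otimes> s \<ominus> a \<otimes> s') = \<zero>" "w \<otimes> (b' \<otimes> t \<ominus> b \<otimes> t') = \<zero>"
      by (auto simp: fraction_eq_iff)
    have "(u \<otimes> w) \<otimes> ((a' \<otimes> t' \<oplus> b' \<otimes> s') \<otimes> (s \<otimes> t) \<ominus> (a \<otimes> t \<oplus> b \<otimes> s) \<otimes> (s' \<otimes> t')) =
      (w \<otimes> t \<otimes> t') \<otimes> (u \<otimes> (a' \<otimes> s \<ominus> a \<otimes> s')) \<oplus> (u \<otimes> s \<otimes> s') \<otimes> (w \<otimes> (b' \<otimes> t \<ominus> b \<otimes> t'))"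
      using car assms uw by (simp, algebra)
    also have "\<dots> = \<zero>"
      unfolding eq using car assms uw by simp
    finally show ?thesis
      using car assms outside_closed uw
      by (subst fraction_eq_iff) (auto intro!: bexI[of _ "u \<otimes> w"])
  qed
  then show ?thesis
    unfolding localization_def ring.simps
    by (subst fraction_combine[OF assms]) auto
qed

lemma fraction_in_localization:
  assumes "a \<in> carrier R" "s \<in> carrier R - I"
  shows "fraction R I a s \<in> carrier (localization R I)"
  using assms by (auto simp: localization_def fraction_def intro!: quotientI)

lemma localization_cases:
  assumes "x \<in> carrier (localization R I)"
  obtains a s where "a \<in> carrier R" "s \<in> carrier R - I" "x = fraction R I a s"
  using assms by (auto simp: localization_def fraction_def elim!: quotientE)

lemma localization_one: "\<one>\<^bsub>localization R I\<^esub> = fraction R I \<one> \<one>"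
  and localization_zero: "\<zero>\<^bsub>localization R I\<^esub> = fraction R I \<zero> \<one>"
  by (simp_all add: localization_def)

lemma cring_localization: "cring (localization R I)"
proof (rule cringI)
  let ?L = "localization R I"
  note sc = outside_closed[unfolded Diff_iff] one_outside[unfolded Diff_iff]
  note rules = fraction_mult fraction_add fraction_in_localization localization_one
    localization_zero sc
  show "abelian_group ?L"
  proof (rule abelian_groupI)
    fix x y assume "x \<in> carrier ?L" "y \<in> carrier ?L"
    then show "x \<oplus>\<^bsub>?L\<^esub> y \<in> carrier ?L"
      by (elim localization_cases) (simp add: rules)
  next
    show "\<zero>\<^bsub>?L\<^esub> \<in> carrier ?L" by (simp add: rules)
  next
    fix x y z assume "x \<in> carrier ?L" "y \<in> carrier ?L" "z \<in> carrier ?L"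
    then show "x \<oplus>\<^bsub>?L\<^esub> y \<oplus>\<^bsub>?L\<^esub> z = x \<oplus>\<^bsub>?L\<^esub> (y \<oplus>\<^bsub>?L\<^esub> z)"
    proof (elim localization_cases, goal_cases)
      case (1 a s b t c r)
      then show ?case
        by (simp add: rules, intro fraction_eqI) (simp_all add: rules, algebra?)
    qed
  next
    fix x y assume "x \<in> carrier ?L" "y \<in> carrier ?L"
    then show "x \<oplus>\<^bsub>?L\<^esub> y = y \<oplus>\<^bsub>?L\<^esub> x"
    proof (elim localization_cases, goal_cases)
      case (1 a s b t)
      then show ?case
        by (simp add: rules, intro fraction_eqI) (simp_all add: rules, algebra?)
    qed
  next
    fix x assume "x \<in> carrier ?L"
    then show "\<zero>\<^bsub>?L\<^esub> \<oplus>\<^bsub>?L\<^esub> x = x"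
      by (elim localization_cases) (simp add: rules)
  next
    fix x assume "x \<in> carrier ?L"
    then show "\<exists>y\<in>carrier ?L. y \<oplus>\<^bsub>?L\<^esub> x = \<zero>\<^bsub>?L\<^esub>"
    proof (elim localization_cases, goal_cases)
      case (1 a s)
      have "fraction R I (\<ominus> a) s \<oplus>\<^bsub>?L\<^esub> x = fraction R I (\<ominus> a \<otimes> s \<oplus> a \<otimes> s) (s \<otimes> s)"
        unfolding 1(3) using 1(1,2) by (intro fraction_add) auto
      also have "\<ominus> a \<otimes> s \<oplus> a \<otimes> s = \<zero>"
        using 1(1,2) by (metis Diff_iff a_inv_closed l_distr l_neg l_null)
      also have "fraction R I \<zero> (s \<otimes> s) = \<zero>\<^bsub>?L\<^esub>"
        unfolding localization_zero
        by (rule fraction_eqI) (use 1(2) outside_closed one_outside in auto)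
      finally have "fraction R I (\<ominus> a) s \<oplus>\<^bsub>?L\<^esub> x = \<zero>\<^bsub>?L\<^esub>" .
      then show ?case
        by (rule bexI) (use 1 in \<open>simp add: fraction_in_localization\<close>)
    qed
  qed
  show "comm_monoid ?L"
  proof (rule comm_monoidI)
    fix x y assume "x \<in> carrier ?L" "y \<in> carrier ?L"
    then show "x \<otimes>\<^bsub>?L\<^esub> y \<in> carrier ?L"
      by (elim localization_cases) (simp add: rules)
  next
    show "\<one>\<^bsub>?L\<^esub> \<in> carrier ?L" by (simp add: rules)
  next
    fix x y z assume "x \<in> carrier ?L" "y \<in> carrier ?L" "z \<in> carrier ?L"
    then show "x \<otimes>\<^bsub>?L\<^esub> y \<otimes>\<^bsub>?L\<^esub> z = x \<otimes>\<^bsub>?L\<^esub> (y \<otimes>\<^bsub>?L\<^esub> z)"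
      by (elim localization_cases) (simp add: rules m_assoc)
  next
    fix x assume "x \<in> carrier ?L"
    then show "\<one>\<^bsub>?L\<^esub> \<otimes>\<^bsub>?L\<^esub> x = x"
      by (elim localization_cases) (simp add: rules)
  next
    fix x y assume "x \<in> carrier ?L" "y \<in> carrier ?L"
    then show "x \<otimes>\<^bsub>?L\<^esub> y = y \<otimes>\<^bsub>?L\<^esub> x"
      by (elim localization_cases) (simp add: rules m_comm)
  qed
  fix x y z assume "x \<in> carrier ?L" "y \<in> carrier ?L" "z \<in> carrier ?L"
  then show "(x \<oplus>\<^bsub>?L\<^esub> y) \<otimes>\<^bsub>?L\<^esub> z = x \<otimes>\<^bsub>?L\<^esub> z \<oplus>\<^bsub>?L\<^esub> y \<otimes>\<^bsub>?L\<^esub> z"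
  proof (elim localization_cases, goal_cases)
    case (1 a s b t c r)
    then have car: "a \<in> carrier R" "b \<in> carrier R" "c \<in> carrier R" "s \<in> carrier R" "t \<in> carrier R"
      "r \<in> carrier R" by auto
    have "fraction R I ((a \<otimes> t \<oplus> b \<otimes> s) \<otimes> c) (s \<otimes> t \<otimes> r) =
      fraction R I (a \<otimes> c \<otimes> (t \<otimes> r) \<oplus> b \<otimes> c \<otimes> (s \<otimes> r)) (s \<otimes> r \<otimes> (t \<otimes> r))"
    proof (rule fraction_eqI)
      show "(a \<otimes> t \<oplus> b \<otimes> s) \<otimes> c \<otimes> (s \<otimes> r \<otimes> (t \<otimes> r)) =
        (a \<otimes> c \<otimes> (t \<otimes> r) \<oplus> b \<otimes> c \<otimes> (s \<otimes> r)) \<otimes> (s \<otimes> t \<otimes> r)"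
        using car by algebra
    qed (use 1 car in \<open>simp_all add: rules\<close>)
    with 1 show ?case by (simp add: rules)
  qed
qed

lemma fraction_nat_pow:
  assumes "a \<in> carrier R"
  shows "fraction R I a \<one> [^]\<^bsub>localization R I\<^esub> (n::nat) = fraction R I (a [^] n) \<one>"
proof -
  interpret L: cring "localization R I" by (rule cring_localization)
  show ?thesis
    using assms one_outside[unfolded Diff_iff]
    by (induction n) (simp_all add: localization_one fraction_mult)
qed

end

section \<open>Length of uniserial local rings\<close>

text \<open>Such a ring is uniserial: an ideal is determined by the least power of \<open>p\<close> that it contains, so a
  strict chain of ideals is a strictly decreasing sequence of exponents in \<open>{0..v}\<close>, and the powers
  of \<open>p\<close> realize all of them.\<close>

lemma (in cring) ring_length_uniserial:
  assumes p: "p \<in> carrier R" and "0 < v"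
    and gen: "\<And>x. x \<in> carrier R \<Longrightarrow> \<exists>u\<in>Units R. \<exists>m::nat. x = u \<otimes> p [^] m"
    and nil: "p [^] v = \<zero>" and nz: "p [^] (v - 1) \<noteq> \<zero>"
  shows "ring_length R = enat v"
proof (rule antisym)
  define ord where "ord J = (LEAST m. p [^] (m::nat) \<in> J)" for J
  have in_J: "p [^] ord J \<in> J" "ord J \<le> v" if "ideal J R" for J
  proof -
    interpret J: ideal J R by (rule that)
    have "p [^] v \<in> J" by (simp add: nil)
    then show "p [^] ord J \<in> J" "ord J \<le> v" unfolding ord_def by (rule LeastI, rule Least_le)
  qed
  have strict: "ord J' < ord J" if "ideal J R" "ideal J' R" "J \<subset> J'" for J J'
  proof -
    interpret J: ideal J R by (rule that)
    interpret J': ideal J' R by (rule that)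
    from that obtain x where x: "x \<in> J'" "x \<notin> J" by auto
    obtain u m where um: "u \<in> Units R" "x = u \<otimes> p [^] (m::nat)"
      using gen x(1) J'.a_Hcarr by meson
    have "inv u \<otimes> x = p [^] m"
      using um p by (simp add: Units_closed m_assoc[symmetric])
    then have pm: "p [^] m \<in> J'"
      using J'.I_l_closed[OF x(1), of "inv u"] um by simp
    have "m < ord J"
    proof (rule ccontr)
      assume "\<not> m < ord J"
      then have "p [^] m = p [^] (m - ord J) \<otimes> p [^] ord J"
        using p by (simp add: nat_pow_mult)
      with in_J[OF that(1)] p have "p [^] m \<in> J" using J.I_l_closed by simp
      with um x show False using J.I_l_closed Units_closed by simp
    qed
    moreover have "ord J' \<le> m" using pm unfolding ord_def by (rule Least_le)
    ultimately show ?thesis by simp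
  qed
  show "ring_length R \<le> enat v"
    unfolding ring_length_def
  proof (rule Sup_least, clarify)
    fix n :: nat and J :: "nat \<Rightarrow> 'a set"
    assume J: "\<forall>k\<le>n. ideal (J k) R" "\<forall>k<n. J k \<subset> J (Suc k)"
    have "ord (J k) + k \<le> v" if "k \<le> n" for k
      using that
    proof (induction k)
      case 0
      then show ?case using in_J J by simp
    next
      case (Suc k)
      then have "ord (J (Suc k)) < ord (J k)" using strict J by simp
      with Suc show ?case by simp
    qed
    from this[of n] show "enat n \<le> enat v" by simp
  qed
next
  have "\<exists>J. (\<forall>k\<le>v. ideal (J k) R) \<and> (\<forall>k<v. J k \<subset> J (Suc k))"
  proof (intro exI conjI allI impI)
    define J where "J k = PIdl (p [^] (v - k))" for k
    show "ideal (J k) R" for k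
      unfolding J_def using p by (intro cgenideal_ideal) simp
    fix k assume k: "k < v"
    then have eq: "p [^] (v - k) = p \<otimes> p [^] (v - Suc k)"
      using p by (metis Suc_diff_Suc nat_pow_Suc2)
    have "J k \<subseteq> J (Suc k)"
      unfolding J_def using p \<open>ideal (J (Suc k)) R\<close> eq
      by (metis cgenideal_minimal cgenideal_self ideal.I_l_closed nat_pow_closed J_def)
    moreover have "J (Suc k) \<noteq> J k"
    proof
      assume "J (Suc k) = J k"
      then have "p [^] (v - Suc k) \<in> J k"
        unfolding J_def using p by (metis cgenideal_self nat_pow_closed)
      then obtain r where r: "r \<in> carrier R" "p [^] (v - Suc k) = r \<otimes> p [^] (v - k)"
        by (auto simp: J_def cgenideal_def)
      have "p [^] (v - 1) = p [^] k \<otimes> p [^] (v - Suc k)"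
        using p k by (simp add: nat_pow_mult)
      also have "\<dots> = r \<otimes> (p [^] k \<otimes> p [^] (v - k))"
        using p r by (simp add: m_lcomm)
      also have "p [^] k \<otimes> p [^] (v - k) = p [^] v"
        using p k by (simp add: nat_pow_mult)
      finally show False using nz nil r by simp
    qed
    ultimately show "J k \<subset> J (Suc k)" by blast
  qed
  then show "enat v \<le> ring_length R"
    unfolding ring_length_def by (intro Sup_upper) auto
qed

text \<open>The hypotheses on \<open>u\<close> say, without mentioning fractions, that \<open>u\<close> generates the maximal ideal of
  the local ring, that its \<open>v\<close>-th power vanishes there, and that the power before does not.\<close>

lemma (in primeideal) ring_length_localization:
  assumes u: "u \<in> carrier R" and v: "0 < v"
    and gen: "\<And>g. g \<in> I \<Longrightarrow> \<exists>c \<in> carrier R - I. \<exists>h \<in> carrier R. c \<otimes> g = u \<otimes> h"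
    and nil: "c0 \<in> carrier R - I" "c0 \<otimes> u [^] v = \<zero>"
    and nz: "\<And>c. c \<in> carrier R - I \<Longrightarrow> c \<otimes> u [^] (v - 1) \<noteq> \<zero>"
  shows "ring_length (localization R I) = enat v"
proof -
  interpret L: cring "localization R I" by (rule cring_localization)
  let ?L = "localization R I"
  note sc = outside_closed[unfolded Diff_iff] one_outside[unfolded Diff_iff]
  note rules = fraction_mult fraction_in_localization localization_one localization_zero sc
  have nil': "fraction R I (u [^] v) \<one> = fraction R I \<zero> \<one>"
    using nil u one_outside by (subst fraction_eq_iff) (auto simp: minus_eq intro!: bexI[of _ c0])
  \<comment> \<open>Splitting off \<open>u\<close> repeatedly ends either with a unit or, after \<open>v\<close> steps, with zero.\<close>
  have div: "(\<exists>m<n. \<exists>c \<in> carrier R - I. \<exists>c' \<in> carrier R - I. c \<otimes> g = c' \<otimes> u [^] m) \<or>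
      (\<exists>c \<in> carrier R - I. \<exists>h \<in> carrier R. c \<otimes> g = h \<otimes> u [^] n)"
    if g: "g \<in> carrier R" for g and n :: nat
  proof (induction n)
    case 0
    show ?case using g one_outside by (intro disjI2 bexI[of _ \<one>] bexI[of _ g]) auto
  next
    case (Suc n)
    then consider "\<exists>m<n. \<exists>c \<in> carrier R - I. \<exists>c' \<in> carrier R - I. c \<otimes> g = c' \<otimes> u [^] m"
      | c h where "c \<in> carrier R - I" "h \<in> carrier R" "c \<otimes> g = h \<otimes> u [^] n" by blast
    then show ?case
    proof cases
      case 1
      then show ?thesis using less_SucI by blast
    next
      case 2
      show ?thesis
      proof (cases "h \<in> I")
        case True
        with gen obtain c' h' where c': "c' \<in> carrier R - I" "h' \<in> carrier R" "c' \<otimes> h = u \<otimes> h'"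
          by blast
        have "(c' \<otimes> c) \<otimes> g = (c' \<otimes> h) \<otimes> u [^] n"
          using 2 c' g u by (metis Diff_iff m_assoc nat_pow_closed)
        also have "\<dots> = h' \<otimes> u [^] Suc n"
          unfolding c'(3) using 2 c' g u by (simp add: m_ac)
        finally show ?thesis using c' 2 outside_closed by blast
      qed (use 2 in blast)
    qed
  qed
  show ?thesis
  proof (rule L.ring_length_uniserial[OF fraction_in_localization[OF u one_outside] v])
    show "fraction R I u \<one> [^]\<^bsub>?L\<^esub> v = \<zero>\<^bsub>?L\<^esub>"
      using u nil' by (simp add: fraction_nat_pow localization_zero)
    show "fraction R I u \<one> [^]\<^bsub>?L\<^esub> (v - 1) \<noteq> \<zero>\<^bsub>?L\<^esub>"
      using u nz one_outside by (auto simp: fraction_nat_pow localization_zero fraction_eq_iff minus_eq)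
    fix x assume "x \<in> carrier ?L"
    then obtain g s where x: "g \<in> carrier R" "s \<in> carrier R - I" "x = fraction R I g s"
      by (rule localization_cases)
    from div[OF x(1), of v] show "\<exists>w\<in>Units ?L. \<exists>m::nat. x = w \<otimes>\<^bsub>?L\<^esub> fraction R I u \<one> [^]\<^bsub>?L\<^esub> m"
    proof (elim disjE exE bexE conjE)
      fix m c c' assume m: "c \<in> carrier R - I" "c' \<in> carrier R - I" "c \<otimes> g = c' \<otimes> u [^] (m::nat)"
      have "fraction R I c' (c \<otimes> s) \<otimes>\<^bsub>?L\<^esub> fraction R I (c \<otimes> s) c' = \<one>\<^bsub>?L\<^esub>"
        using m x(2) by (simp add: rules, intro fraction_eqI) (simp_all add: rules m_ac)
      moreover have "fraction R I c' (c \<otimes> s) \<in> carrier ?L" "fraction R I (c \<otimes> s) c' \<in> carrier ?L"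
        using m x(2) by (simp_all add: rules)
      ultimately have "fraction R I c' (c \<otimes> s) \<in> Units ?L"
        unfolding Units_def using L.m_comm by fastforce
      moreover have "x = fraction R I c' (c \<otimes> s) \<otimes>\<^bsub>?L\<^esub> fraction R I u \<one> [^]\<^bsub>?L\<^esub> m"
      proof -
        have "fraction R I (c' \<otimes> u [^] m) (c \<otimes> s) = fraction R I g s"
          unfolding m(3)[symmetric] using m(1,2) x(1,2) u
          by (intro fraction_eqI) (auto simp: rules m_ac)
        then show ?thesis
          using m x u by (simp add: rules fraction_nat_pow)
      qed
      ultimately show ?thesis by blast
    next
      fix c h assume m: "c \<in> carrier R - I" "h \<in> carrier R" "c \<otimes> g = h \<otimes> u [^] v"
      have "(c0 \<otimes> c) \<otimes> g = h \<otimes> (c0 \<otimes> u [^] v)"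
        using m nil(1) x u by (simp add: m_assoc m_lcomm)
      then have "(c0 \<otimes> c) \<otimes> g = \<zero>" using m nil(2) by simp
      then have "x = \<zero>\<^bsub>?L\<^esub>"
        unfolding x(3) localization_zero using x(1,2) m nil(1) one_outside outside_closed
        by (subst fraction_eq_iff) (auto simp: minus_eq intro!: bexI[of _ "c0 \<otimes> c"])
      moreover have "fraction R I u \<one> [^]\<^bsub>?L\<^esub> v = \<zero>\<^bsub>?L\<^esub>"
        using u nil' by (simp add: fraction_nat_pow localization_zero)
      ultimately show ?thesis
        by (intro bexI[of _ "\<one>\<^bsub>?L\<^esub>"] exI[of _ v]) auto
    qed
  qed
qed

section \<open>The associated graded ring as a quotient of the Rees algebra\<close>

lemma ring_of_type_algebra_simps [simp]:
  "carrier ring_of_type_algebra = UNIV"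
  "x \<otimes>\<^bsub>ring_of_type_algebra\<^esub> y = x * y"
  "x \<oplus>\<^bsub>ring_of_type_algebra\<^esub> y = x + y"
  "\<one>\<^bsub>ring_of_type_algebra\<^esub> = 1"
  "\<zero>\<^bsub>ring_of_type_algebra\<^esub> = 0"
  by (simp_all add: ring_of_type_algebra_def)

lemma ring_of_type_algebra_uminus [simp]:
  "\<ominus>\<^bsub>ring_of_type_algebra\<^esub> x = - (x :: 'a :: comm_ring_1)"
proof -
  interpret ring "ring_of_type_algebra :: 'a ring" by (rule ring_from_type_algebra)
  have "\<ominus>\<^bsub>ring_of_type_algebra\<^esub> x + x = 0" using l_neg[of x] by simp
  then show ?thesis by (simp add: eq_neg_iff_add_eq_0)
qed

lemma ideal_closed:
  fixes I :: "'a :: comm_ring_1 set"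
  assumes "ideal I ring_of_type_algebra"
  shows "0 \<in> I" "\<And>x y. x \<in> I \<Longrightarrow> y \<in> I \<Longrightarrow> x + y \<in> I" "\<And>x y. x \<in> I \<Longrightarrow> y \<in> I \<Longrightarrow> x - y \<in> I"
    "\<And>x r. x \<in> I \<Longrightarrow> r * x \<in> I" "\<And>x r. x \<in> I \<Longrightarrow> x * r \<in> I"
proof -
  interpret ideal I "ring_of_type_algebra" by (rule assms)
  show "0 \<in> I" "\<And>x y. x \<in> I \<Longrightarrow> y \<in> I \<Longrightarrow> x + y \<in> I"
    using additive_subgroup.zero_closed[OF additive_subgroup_axioms]
      additive_subgroup.a_closed[OF additive_subgroup_axioms] by simp_all
  show "\<And>x r. x \<in> I \<Longrightarrow> r * x \<in> I" "\<And>x r. x \<in> I \<Longrightarrow> x * r \<in> I"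
    using I_l_closed I_r_closed by simp_all
  show "x - y \<in> I" if "x \<in> I" "y \<in> I" for x y
    using additive_subgroup.a_closed[OF additive_subgroup_axioms that(1)
        additive_subgroup.a_inv_closed[OF additive_subgroup_axioms that(2)]] by simp
qed

lemma type_ring_idealI:
  fixes I :: "'a :: comm_ring_1 set"
  assumes "0 \<in> I" "\<And>x y. x \<in> I \<Longrightarrow> y \<in> I \<Longrightarrow> x + y \<in> I" "\<And>x r. x \<in> I \<Longrightarrow> r * x \<in> I"
  shows "ideal I ring_of_type_algebra"
proof -
  interpret cring "ring_of_type_algebra :: 'a ring" by (rule cring_from_type_algebra)
  have "- x \<in> I" if "x \<in> I" for x using assms(3)[OF that, of "- 1"] by simp
  then show ?thesis
    using assms
    by (intro idealI ring_axioms add.subgroupI)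
      (auto simp: mult.commute simp flip: a_inv_def)
qed

lemma ideal_sum_closed:
  fixes I :: "'a :: comm_ring_1 set"
  assumes "ideal I ring_of_type_algebra" "\<And>k. k \<in> S \<Longrightarrow> g k \<in> I"
  shows "sum g S \<in> I"
  using assms(2) by (induction S rule: infinite_finite_induct) (auto intro: ideal_closed[OF assms(1)])

lemma type_ring_coset_eq_iff:
  fixes I :: "'a :: comm_ring_1 set"
  assumes I: "ideal I ring_of_type_algebra"
  shows "I +>\<^bsub>ring_of_type_algebra\<^esub> a = I +>\<^bsub>ring_of_type_algebra\<^esub> b \<longleftrightarrow> a - b \<in> I"
proof -
  interpret ideal I ring_of_type_algebra by (rule I)
  have mem: "x \<in> I +>\<^bsub>ring_of_type_algebra\<^esub> b \<longleftrightarrow> x - b \<in> I" for x b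
    by (auto simp: a_r_coset_def' intro!: bexI[of _ "x - b"])
  show ?thesis
  proof
    assume "I +>\<^bsub>ring_of_type_algebra\<^esub> a = I +>\<^bsub>ring_of_type_algebra\<^esub> b"
    then show "a - b \<in> I" using mem[of a a] mem[of a b] ideal_closed(1)[OF I] by simp
  next
    assume ab: "a - b \<in> I"
    have "x - a \<in> I \<longleftrightarrow> x - b \<in> I" for x
      using ideal_closed(2)[OF I, of "x - a" "a - b"] ideal_closed(3)[OF I, of "x - b" "a - b"] ab by auto
    then show "I +>\<^bsub>ring_of_type_algebra\<^esub> a = I +>\<^bsub>ring_of_type_algebra\<^esub> b"
      by (auto simp: mem)
  qed
qed

lemma ideals_set_simps:
  "carrier (ideals_set R) = {I. ideal I R}"
  "A \<otimes>\<^bsub>ideals_set R\<^esub> B = A \<cdot>\<^bsub>R\<^esub> B"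
  "\<one>\<^bsub>ideals_set R\<^esub> = carrier R"
  by (simp_all add: ideals_set_def)

text \<open>The associated graded ring of \<open>I\<close> is studied through the Rees algebra, the polynomials whose
  coefficient in degree \<open>d\<close> lies in \<open>I\<^sup>d\<close>. Its elements are honest polynomials, so multiplication
  is multiplication of polynomials, and \<open>initial\<close> is a surjective homomorphism to the graded ring
  that carries the ring axioms over.\<close>

locale type_ring_ideal =
  fixes I :: "'a :: comm_ring_1 set"
  assumes ideal_I: "ideal I ring_of_type_algebra"
begin

definition pw :: "nat \<Rightarrow> 'a set"
  where "pw d = ideal_power ring_of_type_algebra I d"

abbreviation gr :: "(nat \<Rightarrow> 'a set) ring"
  where "gr \<equiv> assoc_graded ring_of_type_algebra I"

lemmas gr_def = assoc_graded_def[of "ring_of_type_algebra :: 'a ring" I, folded pw_def]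

definition rees :: "'a poly set"
  where "rees = {p. \<forall>d. coeff p d \<in> pw d}"

definition initial :: "'a poly \<Rightarrow> nat \<Rightarrow> 'a set"
  where "initial p d = pw (Suc d) +>\<^bsub>ring_of_type_algebra\<^esub> coeff p d"

sublocale base: cring "ring_of_type_algebra :: 'a ring"
  by (rule cring_from_type_algebra)

sublocale ideals: comm_monoid "ideals_set (ring_of_type_algebra :: 'a ring)"
  by (rule base.ideals_set_is_comm_monoid)

lemma ideal_pw: "ideal (pw d) ring_of_type_algebra"
  using ideals.nat_pow_closed[of I d] ideal_I by (simp add: pw_def ideals_set_def)

lemma pw_0: "pw 0 = UNIV"
  by (simp add: pw_def ideals_set_def)

lemma pw_mult:
  assumes "a \<in> pw d" "b \<in> pw e"
  shows "a * b \<in> pw (d + e)"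
proof -
  have "pw (d + e) = pw d \<otimes>\<^bsub>ideals_set ring_of_type_algebra\<^esub> pw e"
    using ideals.nat_pow_mult[of I d e] ideal_I by (simp add: pw_def ideals_set_def)
  also have "\<dots> = pw d \<cdot>\<^bsub>ring_of_type_algebra\<^esub> pw e" by (simp add: ideals_set_def)
  finally show ?thesis using ideal_prod.prod[OF assms, of ring_of_type_algebra] by simp
qed

lemma pw_Suc_subset: "pw (Suc d) \<subseteq> pw d"
proof -
  have "pw (Suc d) = pw d \<cdot>\<^bsub>ring_of_type_algebra\<^esub> I"
    by (simp add: pw_def ideals_set_def)
  then show ?thesis using base.ideal_prod_inter[OF ideal_pw ideal_I] by auto
qed

lemmas pw_closed = ideal_closed[OF ideal_pw]

lemma rees_closed:
  "0 \<in> rees" "1 \<in> rees"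
  "\<And>p q. p \<in> rees \<Longrightarrow> q \<in> rees \<Longrightarrow> p + q \<in> rees"
  "\<And>p q. p \<in> rees \<Longrightarrow> q \<in> rees \<Longrightarrow> p - q \<in> rees"
  "\<And>p q. p \<in> rees \<Longrightarrow> q \<in> rees \<Longrightarrow> p * q \<in> rees"
proof -
  show "0 \<in> rees" "1 \<in> rees"
    using pw_0 pw_closed(1) by (auto simp: rees_def coeff_1)
  show "p + q \<in> rees" "p - q \<in> rees" if "p \<in> rees" "q \<in> rees" for p q
    using that pw_closed by (auto simp: rees_def)
  show "p * q \<in> rees" if "p \<in> rees" "q \<in> rees" for p q
    unfolding rees_def mem_Collect_eq coeff_mult
  proof (intro allI ideal_sum_closed[OF ideal_pw])
    fix d k :: nat assume "k \<in> {..d}"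
    then show "coeff p k * coeff q (d - k) \<in> pw d"
      using that pw_mult[of "coeff p k" k "coeff q (d - k)" "d - k"] by (simp add: rees_def)
  qed
qed

lemma initial_eq_iff: "initial p = initial q \<longleftrightarrow> (\<forall>d. coeff (p - q) d \<in> pw (Suc d))"
  by (simp add: initial_def fun_eq_iff type_ring_coset_eq_iff[OF ideal_pw])

lemma initial_zero: "initial 0 = \<zero>\<^bsub>gr\<^esub>"
proof -
  have "pw (Suc d) +>\<^bsub>ring_of_type_algebra\<^esub> 0 = pw (Suc d)" for d
    by (auto simp: a_r_coset_def')
  then show ?thesis by (simp add: initial_def gr_def fun_eq_iff)
qed

lemma initial_eq_zero_iff: "initial p = \<zero>\<^bsub>gr\<^esub> \<longleftrightarrow> (\<forall>d. coeff p d \<in> pw (Suc d))"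
  using initial_eq_iff[of p 0] by (simp add: initial_zero)

lemma initial_add: "initial (p + q) = initial p \<oplus>\<^bsub>gr\<^esub> initial q"
proof
  fix d
  interpret J: ideal "pw (Suc d)" ring_of_type_algebra by (rule ideal_pw)
  show "initial (p + q) d = (initial p \<oplus>\<^bsub>gr\<^esub> initial q) d"
    using J.a_rcos_sum[of "coeff p d" "coeff q d"]
    by (simp add: initial_def gr_def)
qed

lemma initial_one: "initial 1 = \<one>\<^bsub>gr\<^esub>"
proof
  fix d
  show "initial 1 d = \<one>\<^bsub>gr\<^esub> d"
    using initial_zero by (auto simp: initial_def gr_def fun_eq_iff coeff_1)
qed

text \<open>Changing the representatives of classes of degree \<open>i\<close> and \<open>k\<close> by elements of \<open>I\<^sup>i\<^sup>+\<^sup>1\<close> and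
  \<open>I\<^sup>k\<^sup>+\<^sup>1\<close> changes the product by an element of \<open>I\<^sup>i\<^sup>+\<^sup>k\<^sup>+\<^sup>1\<close>.\<close>

lemma rcoset_mult_initial:
  assumes "p \<in> rees" "q \<in> rees"
  shows "rcoset_mult ring_of_type_algebra (pw (Suc (i + k))) (initial p i) (initial q k) =
    pw (Suc (i + k)) +>\<^bsub>ring_of_type_algebra\<^esub> (coeff p i * coeff q k)"
proof -
  have self: "a \<in> pw e +>\<^bsub>ring_of_type_algebra\<^esub> a" for a e
    using pw_closed(1)[of e] by (auto simp: a_r_coset_def' intro!: bexI[of _ 0])
  have eq: "pw (Suc (i + k)) +>\<^bsub>ring_of_type_algebra\<^esub> (a * b) =
    pw (Suc (i + k)) +>\<^bsub>ring_of_type_algebra\<^esub> (coeff p i * coeff q k)"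
    if "a \<in> initial p i" "b \<in> initial q k" for a b
  proof -
    from that obtain m n where mn: "m \<in> pw (Suc i)" "n \<in> pw (Suc k)"
      "a = m + coeff p i" "b = n + coeff q k"
      by (auto simp: initial_def a_r_coset_def')
    have ab: "coeff p i \<in> pw i" "b \<in> pw k"
      using assms mn pw_Suc_subset[of k] pw_closed(2)[of n k] by (auto simp: rees_def)
    have "a * b - coeff p i * coeff q k = m * b + coeff p i * n"
      by (simp add: mn algebra_simps)
    also have "\<dots> \<in> pw (Suc (i + k))"
      using pw_mult[OF mn(1) ab(2)] pw_mult[OF ab(1) mn(2)] pw_closed(2) by simp
    finally show ?thesis by (simp add: type_ring_coset_eq_iff[OF ideal_pw])
  qed
  show ?thesis
    unfolding rcoset_mult_def ring_of_type_algebra_simps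
    by (intro UN_constant_eq[of "coeff p i"] UN_constant_eq[of "coeff q k"] ballI eq)
      (simp_all add: initial_def self)
qed

lemma finsum_quotient:
  fixes N :: "'a set" and S :: "'b set"
  assumes N: "ideal N ring_of_type_algebra" and "finite S"
  shows "(\<Oplus>\<^bsub>ring_of_type_algebra Quot N\<^esub>k\<in>S. N +>\<^bsub>ring_of_type_algebra\<^esub> g k) =
    N +>\<^bsub>ring_of_type_algebra\<^esub> (\<Sum>k\<in>S. g k)"
proof -
  interpret N: ideal N ring_of_type_algebra by (rule N)
  interpret Q: ring "ring_of_type_algebra Quot N" by (rule N.quotient_is_ring)
  interpret h: ring_hom_ring ring_of_type_algebra "ring_of_type_algebra Quot N"
    "(+>\<^bsub>ring_of_type_algebra\<^esub>) N" by (rule N.rcos_ring_hom_ring)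
  show ?thesis
    using assms(2)
  proof (induction S rule: finite_induct)
    case empty
    then show ?case using h.hom_zero by simp
  next
    case (insert k S)
    then show ?case
      using h.hom_add[of "g k" "sum g S"] h.hom_closed by (subst Q.finsum_insert) auto
  qed
qed

lemma initial_mult:
  assumes "p \<in> rees" "q \<in> rees"
  shows "initial (p * q) = initial p \<otimes>\<^bsub>gr\<^esub> initial q"
proof
  fix d
  have "rcoset_mult ring_of_type_algebra (pw (Suc d)) (initial p k) (initial q (d - k)) =
    pw (Suc d) +>\<^bsub>ring_of_type_algebra\<^esub> (coeff p k * coeff q (d - k))" if "k \<le> d" for k
    using rcoset_mult_initial[OF assms, of k "d - k"] that by simp
  moreover have "pw (Suc d) +>\<^bsub>ring_of_type_algebra\<^esub> a \<in> carrier (ring_of_type_algebra Quot pw (Suc d))" for a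
    using ring_hom_closed[OF ideal.rcos_ring_hom[OF ideal_pw], of a] by simp
  ultimately have "(initial p \<otimes>\<^bsub>gr\<^esub> initial q) d =
    (\<Oplus>\<^bsub>ring_of_type_algebra Quot pw (Suc d)\<^esub>k\<in>{..d}.
      pw (Suc d) +>\<^bsub>ring_of_type_algebra\<^esub> (coeff p k * coeff q (d - k)))"
    unfolding gr_def monoid.simps
    by (intro abelian_monoid.finsum_cong'[OF abelian_group.axioms(1)[OF ring.axioms(1)[OF
      ideal.quotient_is_ring[OF ideal_pw]]]])
      auto
  then show "initial (p * q) d = (initial p \<otimes>\<^bsub>gr\<^esub> initial q) d"
    by (simp add: finsum_quotient[OF ideal_pw] initial_def coeff_mult)
qed

lemma carrier_gr: "carrier gr = initial ` rees"
proof (intro equalityI subsetI)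
  fix g assume "g \<in> carrier gr"
  then have "\<forall>d. \<exists>a\<in>pw d. g d = pw (Suc d) +>\<^bsub>ring_of_type_algebra\<^esub> a"
    and fin: "finite {d. g d \<noteq> pw (Suc d)}" by (auto simp: gr_def)
  then obtain a where a: "\<And>d. a d \<in> pw d" "\<And>d. g d = pw (Suc d) +>\<^bsub>ring_of_type_algebra\<^esub> a d"
    by metis
  \<comment> \<open>Taking the representative 0 wherever the class vanishes leaves finitely many coefficients.\<close>
  define p where "p = (\<Sum>d\<in>{d. g d \<noteq> pw (Suc d)}. monom (a d) d)"
  have coeff_p: "coeff p d = (if g d \<noteq> pw (Suc d) then a d else 0)" for d
    unfolding p_def coeff_sum coeff_monom using fin by (simp add: sum.delta)
  have "p \<in> rees" using a pw_closed(1) by (simp add: rees_def coeff_p)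
  moreover have "initial p = g"
  proof
    fix d
    show "initial p d = g d"
      using a(2) initial_zero by (auto simp: initial_def coeff_p gr_def fun_eq_iff)
  qed
  ultimately show "g \<in> initial ` rees" by blast
next
  fix g assume "g \<in> initial ` rees"
  then obtain p where p: "p \<in> rees" "g = initial p" by blast
  have "{d. g d \<noteq> pw (Suc d)} \<subseteq> {..degree p}"
  proof
    fix d assume "d \<in> {d. g d \<noteq> pw (Suc d)}"
    then show "d \<in> {..degree p}"
      using initial_zero
      by (intro ccontr[of "d \<in> {..degree p}"]) (auto simp: p initial_def coeff_eq_0 gr_def fun_eq_iff)
  qed
  with p show "g \<in> carrier gr"
    by (auto simp: gr_def rees_def initial_def intro: finite_subset)
qed

lemma cring_gr: "cring gr"
proof -
  interpret poly: cring "ring_of_type_algebra :: 'a poly ring" by (rule cring_from_type_algebra)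
  let ?R = "(ring_of_type_algebra :: 'a poly ring)\<lparr>carrier := rees\<rparr>"
  have "- p \<in> rees" if "p \<in> rees" for p
    using rees_closed(4)[OF rees_closed(1) that] by simp
  then have "subring rees ring_of_type_algebra"
    using rees_closed by (intro poly.subringI) auto
  then interpret R: ring ?R by (rule poly.subring_is_ring)
  have hom: "initial \<in> ring_hom ?R gr"
    by (rule ring_hom_memI) (auto simp: carrier_gr initial_mult initial_add initial_one)
  have "gr\<lparr>carrier := initial ` carrier ?R, zero := initial \<zero>\<^bsub>?R\<^esub>\<rparr> = gr"
    using carrier_gr initial_zero by simp
  with R.ring_hom_imp_img_ring[OF hom] interpret G: ring gr by simp
  show ?thesis
  proof (rule cringI[OF G.is_abelian_group comm_monoidI])
    fix x y assume "x \<in> carrier gr" "y \<in> carrier gr"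
    then show "x \<otimes>\<^bsub>gr\<^esub> y = y \<otimes>\<^bsub>gr\<^esub> x"
      by (auto simp: carrier_gr initial_mult[symmetric] mult.commute)
  qed (auto simp: G.m_assoc G.l_distr)
qed

lemma initial_nat_pow:
  assumes "p \<in> rees"
  shows "p ^ n \<in> rees" "initial p [^]\<^bsub>gr\<^esub> n = initial (p ^ n)"
proof -
  interpret G: cring gr by (rule cring_gr)
  have "p ^ n \<in> rees \<and> initial p [^]\<^bsub>gr\<^esub> n = initial (p ^ n)"
  proof (induction n)
    case 0
    then show ?case by (simp add: initial_one rees_closed)
  next
    case (Suc n)
    then show ?case
      using assms by (simp add: initial_mult[symmetric] rees_closed mult.commute)
  qed
  then show "p ^ n \<in> rees" "initial p [^]\<^bsub>gr\<^esub> n = initial (p ^ n)" by auto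
qed

end

section \<open>Ideals whose powers are cut out by valuations\<close>

text \<open>A valuation \<open>w\<close> with values in \<open>\<nat> \<union> {\<infinity>}\<close>, given by its ideals \<open>F n = {a. w(a) \<ge> n}\<close>. This form never mentions
  the value \<open>\<infinity>\<close>; \<open>F_prime\<close> is the inequality \<open>w(a b) \<le> w(a) + w(b)\<close>.\<close>

locale valuation_filtration =
  fixes F :: "nat \<Rightarrow> 'a :: idom set"
  assumes ideal_F: "ideal (F n) ring_of_type_algebra"
    and F_0: "F 0 = UNIV"
    and F_Suc: "F (Suc n) \<subseteq> F n"
    and F_mult: "a \<in> F m \<Longrightarrow> b \<in> F n \<Longrightarrow> a * b \<in> F (m + n)"
    and F_prime: "a \<in> F m \<Longrightarrow> b \<in> F n \<Longrightarrow> a * b \<in> F (Suc (m + n)) \<Longrightarrow> a \<in> F (Suc m) \<or> b \<in> F (Suc n)"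
begin

lemmas F_closed = ideal_closed[OF ideal_F]

lemma F_antimono: "m \<le> n \<Longrightarrow> a \<in> F n \<Longrightarrow> a \<in> F m"
  using lift_Suc_antimono_le[of F m n] F_Suc by auto

text \<open>If \<open>w(y) = 1\<close>, then \<open>w(a) = w(a y) - 1\<close>.\<close>

lemma F_cancel:
  assumes y: "y \<in> F 1" "y \<notin> F 2" and ay: "a * y \<in> F (Suc n)"
  shows "a \<in> F n"
proof -
  have "a \<in> F m" if "m \<le> n" for m
    using that
  proof (induction m)
    case (Suc m)
    then have "a * y \<in> F (Suc (m + 1))" using ay F_antimono by (metis Suc_eq_plus1 Suc_le_mono)
    with Suc y F_prime[of a m y 1] show ?case by (simp add: numeral_2_eq_2)
  qed (simp add: F_0)
  then show ?thesis by simp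
qed

lemma not_F_mult_power:
  assumes y: "y \<in> F 1" "y \<notin> F 2" and a: "a \<notin> F (Suc n)"
  shows "a * y ^ k \<notin> F (Suc (n + k))"
proof (induction k)
  case 0
  show ?case using a by simp
next
  case (Suc k)
  then show ?case using F_cancel[OF y, of "a * y ^ k" "Suc (n + k)"] by (auto simp: ac_simps)
qed

end

lemma (in valuation_filtration) ideal_prod_subset:
  assumes "A \<subseteq> F m" "B \<subseteq> F n"
  shows "A \<cdot>\<^bsub>ring_of_type_algebra\<^esub> B \<subseteq> F (m + n)"
proof
  fix x assume "x \<in> A \<cdot>\<^bsub>ring_of_type_algebra\<^esub> B"
  then show "x \<in> F (m + n)"
    by (induction x rule: ideal_prod.induct) (use assms in \<open>auto intro: F_mult F_closed(2)\<close>)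
qed

lemma (in valuation_filtration) ideal_power_subset:
  assumes "A \<subseteq> F m"
  shows "ideal_power ring_of_type_algebra A d \<subseteq> F (d * m)"
proof (induction d)
  case 0
  show ?case by (simp add: F_0)
next
  case (Suc d)
  have "ideal_power ring_of_type_algebra A (Suc d) =
      ideal_power ring_of_type_algebra A d \<cdot>\<^bsub>ring_of_type_algebra\<^esub> A"
    by (simp add: ideals_set_simps)
  with ideal_prod_subset[OF Suc assms] show ?case by (simp add: add.commute)
qed

text \<open>The multiplicity of a prime element is a valuation, and so is its pullback along a ring
  homomorphism.\<close>

lemma valuation_filtration_prime_elem:
  fixes q :: "'b :: idom" and \<phi> :: "'a :: idom \<Rightarrow> 'b"
  assumes q: "prime_elem q"
    and hom: "\<phi> 0 = 0" "\<And>a b. \<phi> (a + b) = \<phi> a + \<phi> b" "\<And>a b. \<phi> (a * b) = \<phi> a * \<phi> b"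
  shows "valuation_filtration (\<lambda>n. {a. q ^ n dvd \<phi> a})"
proof (rule valuation_filtration.intro)
  show "ideal {a. q ^ n dvd \<phi> a} ring_of_type_algebra" for n
    by (rule type_ring_idealI) (auto simp: hom)
  show "{a. q ^ 0 dvd \<phi> a} = UNIV" by simp
  show "{a. q ^ Suc n dvd \<phi> a} \<subseteq> {a. q ^ n dvd \<phi> a}" for n
    by (auto intro: dvd_mult_right)
  fix a b m n assume a: "a \<in> {a. q ^ m dvd \<phi> a}" and b: "b \<in> {a. q ^ n dvd \<phi> a}"
  then show "a * b \<in> {a. q ^ (m + n) dvd \<phi> a}" by (auto simp: hom power_add mult_dvd_mono)
  from a b obtain a' b' where ab: "\<phi> a = q ^ m * a'" "\<phi> b = q ^ n * b'" by (auto elim!: dvdE)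
  assume "a * b \<in> {a. q ^ Suc (m + n) dvd \<phi> a}"
  then have "q ^ (m + n) * q dvd q ^ (m + n) * (a' * b')"
    by (simp add: hom ab power_add ac_simps)
  then have "q dvd a' * b'" using q by (simp add: prime_elem_not_zeroI)
  then have "q dvd a' \<or> q dvd b'" using q by (simp add: prime_elem_dvd_mult_iff)
  then show "a \<in> {a. q ^ Suc m dvd \<phi> a} \<or> b \<in> {a. q ^ Suc n dvd \<phi> a}"
    unfolding mem_Collect_eq ab by (auto simp: mult.commute[of q])
qed

text \<open>The valuation \<open>w\<^sub>j\<close> with filtration \<open>F j\<close> takes the minimum \<open>v j\<close> on \<open>I\<close>, and these bounds cut
  out every power of \<open>I\<close>. The element \<open>c j * y\<close>, which lies in \<open>I\<^sup>d\<close> for \<open>d = e j\<close>, singles out the index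
  \<open>j\<close>: it attains the bound on \<open>I\<^sup>d\<close> for \<open>w\<^sub>j\<close> and for no other valuation.
  Its divisibility by \<open>y\<close> is what makes \<open>y\<close> a local generator of the \<open>j\<close>-th prime.\<close>

locale valuation_ideal = type_ring_ideal I for I :: "'a :: idom set" +
  fixes J :: "'j set" and F :: "'j \<Rightarrow> nat \<Rightarrow> 'a set" and v :: "'j \<Rightarrow> nat"
    and y :: 'a and e :: "'j \<Rightarrow> nat" and c :: "'j \<Rightarrow> 'a"
  assumes finite_J: "finite J"
    and v_pos: "j \<in> J \<Longrightarrow> 0 < v j"
    and filtration: "j \<in> J \<Longrightarrow> valuation_filtration (F j)"
    and ideal_power_eq: "ideal_power ring_of_type_algebra I d = {a. \<forall>j\<in>J. a \<in> F j (d * v j)}"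
    and y: "j \<in> J \<Longrightarrow> y \<in> F j 1" "j \<in> J \<Longrightarrow> y \<notin> F j 2"
    and c_self: "j \<in> J \<Longrightarrow> c j * y \<in> F j (e j * v j)" "j \<in> J \<Longrightarrow> c j * y \<notin> F j (Suc (e j * v j))"
    and c_other: "j \<in> J \<Longrightarrow> k \<in> J \<Longrightarrow> k \<noteq> j \<Longrightarrow> c j * y \<in> F k (Suc (e j * v k))"
begin

lemma pw_eq: "pw d = {a. \<forall>j\<in>J. a \<in> F j (d * v j)}"
  unfolding pw_def by (rule ideal_power_eq)

text \<open>The largest \<open>n\<close> with \<open>excess j n p\<close> is the Gauss valuation of \<open>p\<close> that extends \<open>w\<^sub>j\<close> and gives the
  variable the value \<open>- v j\<close>.\<close>

definition excess :: "'j \<Rightarrow> nat \<Rightarrow> 'a poly \<Rightarrow> bool"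
  where "excess j n p \<longleftrightarrow> (\<forall>d. coeff p d \<in> F j (d * v j + n))"

lemma rees_iff: "p \<in> rees \<longleftrightarrow> (\<forall>j\<in>J. excess j 0 p)"
  by (auto simp: rees_def pw_eq excess_def)

text \<open>A shift of the degree by one costs exactly \<open>v j\<close> in the \<open>j\<close>-th bound.\<close>

lemma initial_zero_iff: "initial p = \<zero>\<^bsub>gr\<^esub> \<longleftrightarrow> (\<forall>j\<in>J. excess j (v j) p)"
  by (auto simp: initial_eq_zero_iff pw_eq excess_def add.commute)

lemma excess_antimono: "j \<in> J \<Longrightarrow> m \<le> n \<Longrightarrow> excess j n p \<Longrightarrow> excess j m p"
  unfolding excess_def using valuation_filtration.F_antimono[OF filtration] by (meson add_left_mono)

lemma excess_add: "j \<in> J \<Longrightarrow> excess j n p \<Longrightarrow> excess j n q \<Longrightarrow> excess j n (p + q)"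
  unfolding excess_def by (auto intro: valuation_filtration.F_closed[OF filtration])

lemma excess_diff: "j \<in> J \<Longrightarrow> excess j n p \<Longrightarrow> excess j n q \<Longrightarrow> excess j n (p - q)"
  unfolding excess_def by (auto intro: valuation_filtration.F_closed[OF filtration])

lemma excess_mult:
  assumes j: "j \<in> J" and p: "excess j m p" and q: "excess j n q"
  shows "excess j (m + n) (p * q)"
  unfolding excess_def coeff_mult
proof (intro allI ideal_sum_closed[OF valuation_filtration.ideal_F[OF filtration[OF j]]])
  fix d i :: nat assume "i \<in> {..d}"
  then have "i * v j + (d - i) * v j = d * v j"
    by (simp flip: add_mult_distrib)
  then have split: "d * v j + (m + n) = (i * v j + m) + ((d - i) * v j + n)"
    by simp
  show "coeff p i * coeff q (d - i) \<in> F j (d * v j + (m + n))"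
    unfolding split using p q
    by (intro valuation_filtration.F_mult[OF filtration[OF j]]) (auto simp: excess_def)
qed

lemma excess_one: "j \<in> J \<Longrightarrow> excess j 0 1"
  using rees_closed(2) rees_iff by blast

lemma excess_power: "j \<in> J \<Longrightarrow> excess j m p \<Longrightarrow> excess j (n * m) (p ^ n)"
  by (induction n) (auto intro: excess_one excess_mult)

text \<open>Gauss' lemma: consider the lowest coefficients of \<open>p\<close> and \<open>q\<close> without excess. Every other term of
  the coefficient of \<open>p q\<close> in the sum of their degrees contains a factor of lower degree, which has
  excess, so the product of these two coefficients would have excess as well.\<close>

lemma excess_prime:
  assumes j: "j \<in> J" and p: "excess j 0 p" and q: "excess j 0 q" and pq: "excess j 1 (p * q)"
  shows "excess j 1 p \<or> excess j 1 q"
proof (rule ccontr)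
  interpret valuation_filtration "F j" by (rule filtration[OF j])
  assume "\<not> (excess j 1 p \<or> excess j 1 q)"
  then have ex: "\<exists>d. coeff p d \<notin> F j (d * v j + 1)" "\<exists>d. coeff q d \<notin> F j (d * v j + 1)"
    by (auto simp: excess_def)
  define m where "m = (LEAST d. coeff p d \<notin> F j (d * v j + 1))"
  define n where "n = (LEAST d. coeff q d \<notin> F j (d * v j + 1))"
  have m: "coeff p m \<notin> F j (m * v j + 1)" "\<And>d. d < m \<Longrightarrow> coeff p d \<in> F j (d * v j + 1)"
    unfolding m_def using LeastI_ex[OF ex(1)] not_less_Least by blast+
  have n: "coeff q n \<notin> F j (n * v j + 1)" "\<And>d. d < n \<Longrightarrow> coeff q d \<in> F j (d * v j + 1)"
    unfolding n_def using LeastI_ex[OF ex(2)] not_less_Least by blast+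
  have p0: "coeff p d \<in> F j (d * v j)" and q0: "coeff q d \<in> F j (d * v j)" for d
    using p q by (auto simp: excess_def)
  have rest: "coeff p i * coeff q (m + n - i) \<in> F j ((m + n) * v j + 1)"
    if "i \<in> {..m + n} - {m}" for i
  proof (cases "i < m")
    case True
    have "(i + (m + n - i)) * v j = (m + n) * v j"
      using that by simp
    then have "(m + n) * v j + 1 = (i * v j + 1) + (m + n - i) * v j"
      unfolding add_mult_distrib by simp
    then show ?thesis using F_mult[OF m(2)[OF True] q0] by simp
  next
    case False
    with that have i: "m + n - i < n" by auto
    have "(i + (m + n - i)) * v j = (m + n) * v j"
      using that by simp
    then have "(m + n) * v j + 1 = i * v j + ((m + n - i) * v j + 1)"
      unfolding add_mult_distrib by simp
    then show ?thesis using F_mult[OF p0 n(2)[OF i]] by simp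
  qed
  have "coeff (p * q) (m + n) = coeff p m * coeff q n +
      (\<Sum>i\<in>{..m + n} - {m}. coeff p i * coeff q (m + n - i))"
    unfolding coeff_mult by (subst sum.remove[of _ m]) auto
  then have "coeff p m * coeff q n = coeff (p * q) (m + n) -
      (\<Sum>i\<in>{..m + n} - {m}. coeff p i * coeff q (m + n - i))"
    by simp
  also have "\<dots> \<in> F j ((m + n) * v j + 1)"
    using pq by (intro F_closed ideal_sum_closed[OF ideal_F] rest) (auto simp: excess_def)
  finally have "coeff p m * coeff q n \<in> F j (Suc (m * v j + n * v j))"
    by (simp add: algebra_simps)
  with F_prime[OF p0 q0] m(1) n(1) show False by auto
qed

definition component_prime :: "'j \<Rightarrow> (nat \<Rightarrow> 'a set) set"
  where "component_prime j = initial ` {p \<in> rees. excess j 1 p}"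

lemma initial_in_component_prime:
  assumes j: "j \<in> J" and p: "p \<in> rees"
  shows "initial p \<in> component_prime j \<longleftrightarrow> excess j 1 p"
proof
  assume "initial p \<in> component_prime j"
  then obtain q where q: "q \<in> rees" "excess j 1 q" "initial p = initial q"
    by (auto simp: component_prime_def)
  then have "initial (p - q) = \<zero>\<^bsub>gr\<^esub>" by (simp add: initial_eq_iff initial_eq_zero_iff)
  with j have "excess j (v j) (p - q)" by (simp add: initial_zero_iff)
  moreover have "1 \<le> v j" using v_pos[OF j] by simp
  ultimately have "excess j 1 (p - q)" using excess_antimono[OF j] by blast
  from excess_add[OF j this q(2)] show "excess j 1 p" by simp
qed (use p in \<open>auto simp: component_prime_def\<close>)

lemma constant_excess: "j \<in> J \<Longrightarrow> a \<in> F j n \<Longrightarrow> excess j n [:a:]"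
  unfolding excess_def using valuation_filtration.F_closed(1)[OF filtration]
  by (auto simp: coeff_pCons split: nat.splits)

lemma not_excess_one: "j \<in> J \<Longrightarrow> \<not> excess j 1 1"
proof
  assume j: "j \<in> J" and "excess j 1 1"
  then have "1 \<in> F j 1" by (auto simp: excess_def dest: spec[of _ 0])
  from valuation_filtration.F_mult[OF filtration[OF j] y(1)[OF j] this] y(2)[OF j]
  show False by (simp add: numeral_2_eq_2)
qed

lemma prime_component_prime:
  assumes j: "j \<in> J"
  shows "primeideal (component_prime j) gr"
proof -
  interpret G: cring gr by (rule cring_gr)
  have ideal: "ideal (component_prime j) gr"
  proof (rule idealI[OF G.ring_axioms])
    show "subgroup (component_prime j) (add_monoid gr)"
    proof
      show "component_prime j \<subseteq> carrier (add_monoid gr)"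
        by (auto simp: component_prime_def carrier_gr)
      show "\<one>\<^bsub>add_monoid gr\<^esub> \<in> component_prime j"
        using j rees_closed(1) initial_zero valuation_filtration.F_closed(1)[OF filtration]
        by (auto simp: component_prime_def excess_def intro!: image_eqI[of _ _ 0])
      fix g h assume g: "g \<in> component_prime j"
      then obtain p where p: "p \<in> rees" "excess j 1 p" "g = initial p"
        by (auto simp: component_prime_def)
      have "initial (0 - p) \<oplus>\<^bsub>gr\<^esub> g = \<zero>\<^bsub>gr\<^esub>"
        unfolding p(3) by (simp add: initial_zero flip: initial_add)
      moreover have mp: "0 - p \<in> rees" using p rees_closed by blast
      ultimately have "\<ominus>\<^bsub>gr\<^esub> g = initial (0 - p)"
        using p by (intro G.minus_equality) (auto simp: carrier_gr)
      moreover have "excess j 1 (0 - p)"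
        using j p(2) valuation_filtration.F_closed(1)[OF filtration]
        by (intro excess_diff) (auto simp: excess_def)
      ultimately have "\<ominus>\<^bsub>gr\<^esub> g \<in> component_prime j"
        using mp by (auto simp: component_prime_def)
      then show "inv\<^bsub>add_monoid gr\<^esub> g \<in> component_prime j"
        by (simp add: a_inv_def)
      assume "h \<in> component_prime j"
      then obtain q where q: "q \<in> rees" "excess j 1 q" "h = initial q"
        by (auto simp: component_prime_def)
      show "g \<otimes>\<^bsub>add_monoid gr\<^esub> h \<in> component_prime j"
        using p q j rees_closed(3) by (auto simp: component_prime_def initial_add[symmetric] excess_add)
    qed
  next
    fix g x assume "g \<in> component_prime j" and "x \<in> carrier gr"
    then obtain p q where p: "p \<in> rees" "excess j 1 p" "g = initial p"
      and q: "q \<in> rees" "x = initial q"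
      by (auto simp: component_prime_def carrier_gr)
    have "excess j 1 (q * p)" using excess_mult[OF j _ p(2), of 0 q] q j by (simp add: rees_iff)
    then show "x \<otimes>\<^bsub>gr\<^esub> g \<in> component_prime j" "g \<otimes>\<^bsub>gr\<^esub> x \<in> component_prime j"
      using p q rees_closed(5) initial_in_component_prime[OF j]
      by (simp_all add: mult.commute flip: initial_mult)
  qed
  show ?thesis
  proof (rule primeidealI[OF ideal cring_gr])
    show "carrier gr \<noteq> component_prime j"
      using initial_in_component_prime[OF j rees_closed(2)] not_excess_one[OF j] rees_closed(2)
      by (auto simp: carrier_gr)
    fix g h assume "g \<in> carrier gr" "h \<in> carrier gr" and gh: "g \<otimes>\<^bsub>gr\<^esub> h \<in> component_prime j"
    then obtain p q where p: "p \<in> rees" "g = initial p" and q: "q \<in> rees" "h = initial q"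
      by (auto simp: carrier_gr)
    have "excess j 1 (p * q)"
      using gh p q initial_in_component_prime[OF j rees_closed(5)[OF p(1) q(1)]]
      by (simp add: initial_mult)
    with excess_prime[OF j] p q j show "g \<in> component_prime j \<or> h \<in> component_prime j"
      by (simp add: initial_in_component_prime rees_iff)
  qed
qed

text \<open>Otherwise the prime avoids an element of each \<open>component_prime j\<close>, hence also their product, of
  which all excesses are positive. But a sufficiently high power of that product has \<open>j\<close>-th excess at
  least \<open>v j\<close> for all \<open>j\<close> and is zero.\<close>

lemma prime_contains_component_prime:
  assumes Q: "primeideal Q gr"
  shows "\<exists>j\<in>J. component_prime j \<subseteq> Q"
proof (rule ccontr)
  assume "\<not> (\<exists>j\<in>J. component_prime j \<subseteq> Q)"
  then have escape: "\<exists>q\<in>rees. excess j 1 q \<and> initial q \<notin> Q" if "j \<in> J" for j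
    using that by (fastforce simp: component_prime_def)
  interpret Q: primeideal Q gr by (rule Q)
  have one: "\<one>\<^bsub>gr\<^esub> \<notin> Q" using Q.one_outside by simp
  have "\<exists>p\<in>rees. initial p \<notin> Q \<and> (\<forall>j\<in>S. excess j 1 p)" if "finite S" "S \<subseteq> J" for S
    using that
  proof (induction S rule: finite_induct)
    case empty
    then show ?case using one rees_closed(2) initial_one by (intro bexI[of _ 1]) auto
  next
    case (insert j S)
    then obtain p q where p: "p \<in> rees" "initial p \<notin> Q" "\<forall>k\<in>S. excess k 1 p"
      and q: "q \<in> rees" "initial q \<notin> Q" "excess j 1 q" using escape[of j] by auto
    have "initial (p * q) \<notin> Q"
      using p q Q.I_prime[of "initial p" "initial q"] by (auto simp: carrier_gr initial_mult)
    moreover have "excess k 1 (p * q)" if "k \<in> insert j S" for k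
    proof (cases "k = j")
      case True
      then show ?thesis using excess_mult[of k 0 p 1 q] p q that insert by (auto simp: rees_iff)
    next
      case False
      then show ?thesis using excess_mult[of k 1 p 0 q] p q that insert by (auto simp: rees_iff)
    qed
    ultimately show ?case using rees_closed(5)[OF p(1) q(1)] by blast
  qed
  from this[OF finite_J] obtain p where p: "p \<in> rees" "initial p \<notin> Q" "\<forall>j\<in>J. excess j 1 p"
    by blast
  define N where "N = (\<Sum>j\<in>J. v j)"
  have "excess j (v j) (p ^ N)" if "j \<in> J" for j
    using excess_power[OF that, of 1 p N] excess_antimono[OF that, of "v j" N] p(3) that
      member_le_sum[of j J v] finite_J by (auto simp: N_def)
  then have "initial (p ^ N) = \<zero>\<^bsub>gr\<^esub>" by (simp add: initial_zero_iff)
  then have "initial p [^]\<^bsub>gr\<^esub> N \<in> Q"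
    using initial_nat_pow(2)[OF p(1)] Q.additive_subgroup_axioms additive_subgroup.zero_closed
    by fastforce
  moreover have "initial p [^]\<^bsub>gr\<^esub> n \<notin> Q" for n :: nat
  proof (induction n)
    case (Suc n)
    have "initial p \<in> carrier gr" "initial p [^]\<^bsub>gr\<^esub> n \<in> carrier gr"
      using p(1) initial_nat_pow[OF p(1)] by (auto simp: carrier_gr)
    with Suc p(2) Q.I_prime show ?case unfolding Q.nat_pow_Suc by blast
  qed (simp add: one)
  ultimately show False by blast
qed

text \<open>Its class in the associated graded ring lies in all \<open>component_prime k\<close> except the \<open>j\<close>-th
  one; it becomes invertible exactly at the component \<open>j\<close>.\<close>

abbreviation marker :: "'j \<Rightarrow> 'a poly"
  where "marker j \<equiv> monom (c j * y) (e j)"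

lemma marker_excess:
  assumes j: "j \<in> J"
  shows "excess j 0 (marker j)" "\<not> excess j 1 (marker j)"
    "\<And>k. k \<in> J \<Longrightarrow> k \<noteq> j \<Longrightarrow> excess k 1 (marker j)" "marker j \<in> rees"
proof -
  show *: "excess j 0 (marker j)" "\<not> excess j 1 (marker j)"
    using c_self[OF j] valuation_filtration.F_closed(1)[OF filtration[OF j]]
    by (auto simp: excess_def intro!: exI[of _ "e j"])
  show **: "excess k 1 (marker j)" if "k \<in> J" "k \<noteq> j" for k
    using c_other[OF j that] valuation_filtration.F_closed(1)[OF filtration[OF that(1)]]
    by (auto simp: excess_def)
  show "marker j \<in> rees"
    unfolding rees_iff using * ** excess_antimono[of _ 0 1] by (metis zero_le)
qed

lemma component_prime_incomparable:
  assumes "j \<in> J" "k \<in> J" "component_prime j \<subseteq> component_prime k"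
  shows "j = k"
proof (rule ccontr)
  assume "j \<noteq> k"
  with assms marker_excess have "initial (marker k) \<in> component_prime j"
    by (simp add: initial_in_component_prime)
  with assms(3) have "initial (marker k) \<in> component_prime k" by blast
  with assms marker_excess show False by (simp add: initial_in_component_prime)
qed

text \<open>An element \<open>p\<close> of the \<open>j\<close>-th prime becomes divisible by \<open>y\<close> after multiplication by the marker. The
  quotient stays in the Rees algebra because division by \<open>y\<close> lowers each value by one: for \<open>w\<^sub>j\<close> this is
  paid by the excess of \<open>p\<close>, for the other valuations by that of the marker.\<close>

lemma marker_quotient_mult_rees:
  assumes j: "j \<in> J" and p: "p \<in> rees" "excess j 1 p"
  shows "monom (c j) (e j) * p \<in> rees"
  unfolding rees_iff
proof
  fix k assume k: "k \<in> J"
  interpret valuation_filtration "F k" by (rule filtration[OF k])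
  have "c j * coeff p (d - e j) \<in> F k (d * v k)" if d: "e j \<le> d" for d
  proof -
    have split: "d * v k = e j * v k + (d - e j) * v k"
      using d by (simp flip: add_mult_distrib)
    show ?thesis
    proof (cases "k = j")
      case True
      \<comment> \<open>If \<open>e j * v j = 0\<close>, the subtraction is truncated, and the claim is \<open>c j * y \<in> F j 1\<close>.\<close>
      have "c j * y \<in> F j (Suc (e j * v j - 1))"
        using c_self(1)[OF j] F_antimono y(1)[OF j] F_closed(4) True
        by (cases "e j * v j") auto
      then have "c j \<in> F k (e j * v j - 1)"
        using F_cancel y[OF j] True by blast
      moreover have "coeff p (d - e j) \<in> F k ((d - e j) * v j + 1)"
        using p(2) True by (simp add: excess_def)
      ultimately have "c j * coeff p (d - e j) \<in> F k ((e j * v j - 1) + ((d - e j) * v j + 1))"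
        using True by (intro F_mult) auto
      then show ?thesis
        by (rule F_antimono[rotated]) (use split True in simp)
    next
      case False
      then have "c j \<in> F k (e j * v k)"
        using F_cancel[OF y[OF k]] c_other[OF j k] by blast
      moreover have "coeff p (d - e j) \<in> F k ((d - e j) * v k)"
        using p(1) k by (simp add: rees_iff excess_def)
      ultimately show ?thesis unfolding split by (rule F_mult)
    qed
  qed
  then show "excess k 0 (monom (c j) (e j) * p)"
    using F_closed(1) by (simp add: excess_def coeff_monom_mult)
qed

text \<open>At the \<open>j\<close>-th component the marker is a unit that raises all other excesses without changing the
  \<open>j\<close>-th one. So an element is locally zero as soon as its \<open>j\<close>-th excess reaches \<open>v j\<close>, and \<open>y\<close>, of
  excess one, is a uniformizer.\<close>

lemma ring_length_component:
  assumes j: "j \<in> J"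
  shows "ring_length (localization gr (component_prime j)) = enat (v j)"
proof -
  interpret P: primeideal "component_prime j" gr by (rule prime_component_prime[OF j])
  note mem = initial_in_component_prime[OF j]
  have y_rees: "[:y:] \<in> rees"
    unfolding rees_iff using constant_excess[OF _ y(1)] excess_antimono[of _ 0 1] by (metis zero_le)
  have pow: "initial [:y:] [^]\<^bsub>gr\<^esub> n = initial ([:y:] ^ n)" "[:y:] ^ n \<in> rees" for n :: nat
    using initial_nat_pow[OF y_rees] by auto
  define N where "N = (\<Sum>k\<in>J. v k)"
  have N: "v k \<le> N" if "k \<in> J" for k
    unfolding N_def using that finite_J by (intro member_le_sum) auto
  have marker_pow: "marker j ^ n \<in> rees" "\<not> excess j 1 (marker j ^ n)" for n
  proof -
    show "marker j ^ n \<in> rees" using initial_nat_pow(1) marker_excess(4)[OF j] by blast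
    show "\<not> excess j 1 (marker j ^ n)"
    proof (induction n)
      case (Suc n)
      then show ?case
        using excess_prime[OF j, of "marker j" "marker j ^ n"] marker_excess[OF j]
          excess_power[OF j, of 0 "marker j" n] by auto
    qed (use not_excess_one[OF j] in simp)
  qed
  show ?thesis
  proof (rule P.ring_length_localization[of "initial [:y:]" "v j" "initial (marker j ^ N)"])
    show "initial [:y:] \<in> carrier gr" using y_rees by (auto simp: carrier_gr)
    show "0 < v j" by (rule v_pos[OF j])
    show "initial (marker j ^ N) \<in> carrier gr - component_prime j"
      using marker_pow mem by (auto simp: carrier_gr)
    have "excess k (v k) (marker j ^ N * [:y:] ^ v j)" if k: "k \<in> J" for k
    proof (cases "k = j")
      case True
      have "excess j (N * 0 + v j * 1) (marker j ^ N * [:y:] ^ v j)"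
        using marker_excess(1) constant_excess y(1) j by (intro excess_mult excess_power) auto
      with True show ?thesis by simp
    next
      case False
      have "excess k (N * 1 + v j * 0) (marker j ^ N * [:y:] ^ v j)"
        using marker_excess(3) False j k y_rees by (intro excess_mult excess_power) (auto simp: rees_iff)
      then show ?thesis using excess_antimono[OF k N[OF k]] by simp
    qed
    then show "initial (marker j ^ N) \<otimes>\<^bsub>gr\<^esub> initial [:y:] [^]\<^bsub>gr\<^esub> v j = \<zero>\<^bsub>gr\<^esub>"
      using marker_pow pow by (simp add: initial_zero_iff flip: initial_mult)
  next
    fix g assume "g \<in> component_prime j"
    then obtain p where p: "p \<in> rees" "excess j 1 p" "g = initial p"
      by (auto simp: component_prime_def)
    have "marker j = [:y:] * monom (c j) (e j)"
      by (simp add: smult_monom mult.commute)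
    then have "marker j * p = [:y:] * (monom (c j) (e j) * p)"
      by (simp only: mult.assoc)
    then have "initial (marker j) \<otimes>\<^bsub>gr\<^esub> g = initial [:y:] \<otimes>\<^bsub>gr\<^esub> initial (monom (c j) (e j) * p)"
      using p y_rees marker_excess(4)[OF j] marker_quotient_mult_rees[OF j p(1,2)]
      by (simp flip: initial_mult)
    moreover have "initial (marker j) \<in> carrier gr - component_prime j"
      using marker_excess[OF j] mem by (auto simp: carrier_gr)
    moreover have "initial (monom (c j) (e j) * p) \<in> carrier gr"
      using marker_quotient_mult_rees[OF j p(1,2)] by (auto simp: carrier_gr)
    ultimately show "\<exists>c\<in>carrier gr - component_prime j. \<exists>h\<in>carrier gr.
        c \<otimes>\<^bsub>gr\<^esub> g = initial [:y:] \<otimes>\<^bsub>gr\<^esub> h" by blast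
  next
    fix x assume "x \<in> carrier gr - component_prime j"
    then obtain p where p: "p \<in> rees" "\<not> excess j 1 p" "x = initial p"
      using mem by (auto simp: carrier_gr)
    then obtain d where d: "coeff p d \<notin> F j (Suc (d * v j))" by (auto simp: excess_def)
    have "coeff (p * [:y:] ^ n) d = coeff p d * y ^ n" for n
      by (simp add: poly_const_pow mult.commute)
    then have "coeff (p * [:y:] ^ (v j - 1)) d \<notin> F j (d * v j + v j)"
      using valuation_filtration.not_F_mult_power[OF filtration[OF j] y[OF j] d, of "v j - 1"]
        v_pos[OF j] by simp
    then have "\<not> excess j (v j) (p * [:y:] ^ (v j - 1))" by (auto simp: excess_def)
    then show "x \<otimes>\<^bsub>gr\<^esub> initial [:y:] [^]\<^bsub>gr\<^esub> (v j - 1) \<noteq> \<zero>\<^bsub>gr\<^esub>"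
      using p pow j by (auto simp: initial_zero_iff simp flip: initial_mult)
  qed
qed

theorem behrend_number_valuation_ideal:
  "behrend_number ring_of_type_algebra I = enat (\<Sum>j\<in>J. v j)"
proof -
  have spec: "component_prime ` J \<subseteq> spec gr"
    using prime_component_prime by (auto simp: spec_def)
  have comps: "irreducible_components (normal_cone ring_of_type_algebra I) =
      vanishing_locus gr ` component_prime ` J"
    unfolding normal_cone_def
  proof (rule irreducible_components_zariski[OF finite_imageI[OF finite_J] spec])
    show "\<exists>P\<in>component_prime ` J. P \<subseteq> Q" if "Q \<in> spec gr" for Q
      using that prime_contains_component_prime by (auto simp: spec_def)
    show "P = Q" if "P \<in> component_prime ` J" "Q \<in> component_prime ` J" "P \<subseteq> Q" for P Q
      using that component_prime_incomparable by blast
  qed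
  have gen: "generic_point (normal_cone ring_of_type_algebra I) (vanishing_locus gr (component_prime j)) =
      component_prime j" if "j \<in> J" for j
    unfolding normal_cone_def using that spec by (intro generic_point_vanishing_locus) auto
  have "inj_on (\<lambda>j. vanishing_locus gr (component_prime j)) J"
    using gen component_prime_incomparable by (intro inj_onI) (metis order_refl)
  then have "behrend_number ring_of_type_algebra I =
      (\<Sum>j\<in>J. ring_length (localization gr (component_prime j)))"
    unfolding behrend_number_def comps image_image by (subst sum.reindex) (auto simp: gen)
  also have "\<dots> = (\<Sum>j\<in>J. enat (v j))" by (intro sum.cong ring_length_component) auto
  also have "\<dots> = enat (\<Sum>j\<in>J. v j)"
    using finite_J by (induction J rule: finite_induct) (auto simp: zero_enat_def)
  finally show ?thesis .
qed

end

section \<open>Monomial valuations on the plane\<close>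

lemma pcompose_power: "pcompose (p ^ n) q = pcompose p q ^ n"
  by (induction n) (simp_all add: pcompose_mult pcompose_1)

lemma plane_y_power: "plane_y ^ n = [:monom 1 n:]"
  by (simp add: plane_y_def poly_const_pow monom_altdef)

lemma plane_x_power: "plane_x ^ n = monom 1 n"
  by (simp add: plane_x_def monom_altdef)

lemma prime_elem_plane_y: "prime_elem plane_y"
  unfolding plane_y_def prime_elem_const_poly_iff by (rule prime_elem_linear_field_poly) simp

locale curve_coordinate =
  fixes f :: "complex poly"
begin

definition curve :: "complex poly poly"
  where "curve = plane_x + [:f:]"

text \<open>The automorphism of the plane that turns \<open>curve\<close> into the coordinate function \<open>x\<close>.\<close>

definition straighten :: "complex poly poly \<Rightarrow> complex poly poly"
  where "straighten p = pcompose p [:- f, 1:]"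

definition coef :: "complex poly poly \<Rightarrow> nat \<Rightarrow> nat \<Rightarrow> complex"
  where "coef p a b = coeff (coeff (straighten p) a) b"

text \<open>The substitution takes \<open>curve\<close> to \<open>x y\<^sup>r\<close> and fixes \<open>y\<close>, so the multiplicity of \<open>y\<close> after it is the
  monomial valuation with value \<open>r\<close> on \<open>curve\<close> and 1 on \<open>y\<close>.\<close>

definition F :: "nat \<Rightarrow> nat \<Rightarrow> complex poly poly set"
  where "F r n = {p. plane_y ^ n dvd pcompose p [:- f, monom 1 r:]}"

lemma valuation_filtration_F: "valuation_filtration (F r)"
  unfolding F_def
  by (intro valuation_filtration_prime_elem prime_elem_plane_y) (simp_all add: pcompose_add pcompose_mult)

lemma in_F_iff: "p \<in> F r n \<longleftrightarrow> (\<forall>a b. coef p a b \<noteq> 0 \<longrightarrow> n \<le> r * a + b)"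
proof -
  have "pcompose p [:- f, monom 1 r:] = pcompose (straighten p) [:0, monom 1 r:]"
    unfolding straighten_def by (simp add: pcompose_pCons flip: pcompose_assoc)
  then have "coeff (pcompose p [:- f, monom 1 r:]) a = monom 1 (r * a) * coeff (straighten p) a" for a
    by (simp add: coeff_pcompose_linear monom_power)
  then have "p \<in> F r n \<longleftrightarrow> (\<forall>a. monom 1 n dvd monom 1 (r * a) * coeff (straighten p) a)"
    by (simp add: F_def plane_y_power const_poly_dvd_iff)
  also have "\<dots> \<longleftrightarrow> (\<forall>a b. coef p a b \<noteq> 0 \<longrightarrow> n \<le> r * a + b)"
  proof (intro iff_allI)
    fix a
    have "monom 1 n dvd monom 1 (r * a) * coeff (straighten p) a \<longleftrightarrow>
        (\<forall>k<n. r * a \<le> k \<longrightarrow> coef p a (k - r * a) = 0)"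
      by (auto simp: monom_1_dvd_iff' coeff_monom_mult coef_def)
    also have "\<dots> \<longleftrightarrow> (\<forall>b. coef p a b \<noteq> 0 \<longrightarrow> n \<le> r * a + b)"
      by (metis add_diff_cancel_left' le_add1 le_add_diff_inverse not_le)
    finally show "monom 1 n dvd monom 1 (r * a) * coeff (straighten p) a \<longleftrightarrow>
        (\<forall>b. coef p a b \<noteq> 0 \<longrightarrow> n \<le> r * a + b)" .
  qed
  finally show ?thesis .
qed

lemma coef_simps [simp]:
  "coef 0 a b = 0"
  "coef (p + q) a b = coef p a b + coef q a b"
  "coef (p - q) a b = coef p a b - coef q a b"
  "coef ([:[:t:]:] * p) a b = t * coef p a b"
  by (simp_all add: coef_def straighten_def pcompose_add pcompose_diff pcompose_smult)

lemma coef_sum: "coef (sum g S) a b = (\<Sum>k\<in>S. coef (g k) a b)"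
  by (induction S rule: infinite_finite_induct) simp_all

lemma coef_monomial: "coef (curve ^ a * plane_y ^ b) a' b' = (if a' = a \<and> b' = b then 1 else 0)"
proof -
  have "straighten curve = plane_x"
    by (simp add: straighten_def curve_def plane_x_def pcompose_pCons)
  then have "straighten (curve ^ a * plane_y ^ b) = plane_x ^ a * [:monom 1 b:]"
    by (simp add: straighten_def pcompose_mult pcompose_smult plane_y_power pcompose_power)
  also have "\<dots> = monom (monom 1 b) a"
    by (simp add: plane_x_power smult_monom)
  finally show ?thesis by (auto simp: coef_def)
qed

lemma monomial_in_F_iff: "curve ^ a * plane_y ^ b \<in> F r n \<longleftrightarrow> n \<le> r * a + b"
  by (simp add: in_F_iff coef_monomial)

text \<open>Taylor expansion of \<open>p\<close> in the coordinates \<open>curve\<close> and \<open>y\<close>.\<close>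

lemma polynomial_in_ideal:
  assumes I: "ideal I plane_ring"
    and mono: "\<And>a b. coef p a b \<noteq> 0 \<Longrightarrow> curve ^ a * plane_y ^ b \<in> I"
  shows "p \<in> I"
proof -
  let ?q = "straighten p"
  have "p = pcompose ?q curve"
    unfolding straighten_def curve_def plane_x_def
    by (simp add: pcompose_pCons pcompose_idR flip: pcompose_assoc)
  also have "?q = (\<Sum>a\<le>degree ?q. [:coeff ?q a:] * plane_x ^ a)"
    using poly_as_sum_of_monoms[of ?q] by (simp add: plane_x_power smult_monom)
  also have "pcompose \<dots> curve = (\<Sum>a\<le>degree ?q. [:coeff ?q a:] * curve ^ a)"
    unfolding pcompose_sum pcompose_mult pcompose_const pcompose_power
    by (simp add: plane_x_def pcompose_pCons)
  finally have p: "p = (\<Sum>a\<le>degree ?q. [:coeff ?q a:] * curve ^ a)" .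
  have "[:coeff ?q a:] * curve ^ a \<in> I" for a
  proof -
    have "[:coeff ?q a:] = (\<Sum>b\<le>degree (coeff ?q a). [:monom (coef p a b) b:])"
      unfolding coef_def sum_to_poly poly_as_sum_of_monoms ..
    then have "[:coeff ?q a:] * curve ^ a =
        (\<Sum>b\<le>degree (coeff ?q a). [:[:coef p a b:]:] * (curve ^ a * plane_y ^ b))"
      by (simp only: sum_distrib_right) (simp add: plane_y_power smult_monom mult.commute)
    also have "\<dots> \<in> I"
    proof (rule ideal_sum_closed[OF I])
      fix b
      show "[:[:coef p a b:]:] * (curve ^ a * plane_y ^ b) \<in> I"
      proof (cases "coef p a b = 0")
        case True
        then show ?thesis using ideal_closed(1)[OF I] by simp
      next
        case False
        then show ?thesis by (intro ideal_closed(4)[OF I] mono)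
      qed
    qed
    finally show ?thesis .
  qed
  then show ?thesis by (subst p) (intro ideal_sum_closed[OF I])
qed

end

section \<open>Colength of monomial ideals\<close>

context curve_coordinate
begin

text \<open>The spans \<open>E S\<close> of the monomials with exponents in \<open>S \<subseteq> D\<close> gain one dimension with each new exponent
  because no combination with a nonzero coefficient inside \<open>D\<close> lies in \<open>K\<close>.\<close>

lemma has_colength_monomial_ideal:
  assumes K: "ideal K plane_ring" and D: "finite D"
    and K_iff: "\<And>p. p \<in> K \<longleftrightarrow> (\<forall>a b. coef p a b \<noteq> 0 \<longrightarrow> (a, b) \<notin> D)"
  shows "has_colength K (card D)"
proof -
  let ?Q = "plane_ring Quot K"
  let ?C = "range (\<lambda>c :: complex. K +>\<^bsub>plane_ring\<^esub> [:[:c:]:])"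
  interpret K: ideal K plane_ring by (rule K)
  interpret Q: ring ?Q by (rule K.quotient_is_ring)
  have cls_add: "(K +>\<^bsub>plane_ring\<^esub> p) \<oplus>\<^bsub>?Q\<^esub> (K +>\<^bsub>plane_ring\<^esub> q) = K +>\<^bsub>plane_ring\<^esub> (p + q)"
    and cls_mult: "(K +>\<^bsub>plane_ring\<^esub> p) \<otimes>\<^bsub>?Q\<^esub> (K +>\<^bsub>plane_ring\<^esub> q) = K +>\<^bsub>plane_ring\<^esub> (p * q)"
    and cls_carrier: "K +>\<^bsub>plane_ring\<^esub> p \<in> carrier ?Q" for p q
    using ring_hom_add[OF K.rcos_ring_hom, of p q] ring_hom_mult[OF K.rcos_ring_hom, of p q]
      ring_hom_closed[OF K.rcos_ring_hom, of p] by simp_all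
  have cls_zero: "K +>\<^bsub>plane_ring\<^esub> 0 = \<zero>\<^bsub>?Q\<^esub>"
    using ring_hom_zero[OF K.rcos_ring_hom K.ring_axioms Q.ring_axioms] by simp
  have carrier: "carrier ?Q = range (\<lambda>p. K +>\<^bsub>plane_ring\<^esub> p)"
    by (auto simp: FactRing_def A_RCOSETS_def RCOSETS_def a_r_coset_def)
  define E where "E S = {K +>\<^bsub>plane_ring\<^esub> p | p. \<forall>a b. coef p a b \<noteq> 0 \<longrightarrow> (a, b) \<in> S}" for S
  have dim: "Q.dimension (card S) ?C (E S)" if "finite S" "S \<subseteq> D" for S
    using that
  proof (induction S rule: finite_induct)
    case empty
    have "K +>\<^bsub>plane_ring\<^esub> p = \<zero>\<^bsub>?Q\<^esub>" if "\<forall>a b. coef p a b = 0" for p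
    proof -
      have "p \<in> K" using that by (simp add: K_iff)
      then show ?thesis using type_ring_coset_eq_iff[OF K, of p 0] by (simp add: cls_zero)
    qed
    then have "E {} \<subseteq> {\<zero>\<^bsub>?Q\<^esub>}" unfolding E_def by blast
    moreover have "\<zero>\<^bsub>?Q\<^esub> \<in> E {}"
      unfolding E_def mem_Collect_eq by (rule exI[of _ 0]) (simp add: cls_zero)
    ultimately have "E {} = {\<zero>\<^bsub>?Q\<^esub>}" by blast
    then show ?case by simp
  next
    case (insert m S)
    obtain a b where m: "m = (a, b)" by (cases m)
    let ?v = "K +>\<^bsub>plane_ring\<^esub> (curve ^ a * plane_y ^ b)"
    have "?v \<notin> E S"
    proof
      assume "?v \<in> E S"
      then obtain p where p: "\<forall>a b. coef p a b \<noteq> 0 \<longrightarrow> (a, b) \<in> S" "curve ^ a * plane_y ^ b - p \<in> K"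
        using type_ring_coset_eq_iff[OF K] by (auto simp: E_def)
      have "coef p a b = 0" using p(1) insert m by blast
      then have "coef (curve ^ a * plane_y ^ b - p) a b \<noteq> 0" by (simp add: coef_monomial)
      with p(2) insert m show False unfolding K_iff by blast
    qed
    then have "Q.dimension (Suc (card S)) ?C (Q.line_extension ?C ?v (E S))"
      using insert cls_carrier by (intro Q.Suc_dim) auto
    moreover have "Q.line_extension ?C ?v (E S) = E (insert m S)"
    proof (intro equalityI subsetI)
      fix x assume "x \<in> Q.line_extension ?C ?v (E S)"
      then obtain t p where p: "\<forall>a b. coef p a b \<noteq> 0 \<longrightarrow> (a, b) \<in> S"
        "x = ((K +>\<^bsub>plane_ring\<^esub> [:[:t:]:]) \<otimes>\<^bsub>?Q\<^esub> ?v) \<oplus>\<^bsub>?Q\<^esub> (K +>\<^bsub>plane_ring\<^esub> p)"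
        by (auto simp: Q.line_extension_def set_add_def' r_coset_def E_def)
      then have "x = K +>\<^bsub>plane_ring\<^esub> ([:[:t:]:] * (curve ^ a * plane_y ^ b) + p)"
        by (simp only: cls_add cls_mult)
      moreover have "(a', b') \<in> insert m S" if "coef ([:[:t:]:] * (curve ^ a * plane_y ^ b) + p) a' b' \<noteq> 0" for a' b'
        using that p(1) m unfolding coef_simps coef_monomial by (auto split: if_splits)
      ultimately show "x \<in> E (insert m S)" unfolding E_def by blast
    next
      fix x assume "x \<in> E (insert m S)"
      then obtain p where p: "\<forall>a b. coef p a b \<noteq> 0 \<longrightarrow> (a, b) \<in> insert m S" "x = K +>\<^bsub>plane_ring\<^esub> p"
        by (auto simp: E_def)
      define q where "q = p - [:[:coef p a b:]:] * (curve ^ a * plane_y ^ b)"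
      have "(a', b') \<in> S" if "coef q a' b' \<noteq> 0" for a' b'
        using that p(1) m unfolding q_def coef_simps coef_monomial by (auto split: if_splits)
      then have "K +>\<^bsub>plane_ring\<^esub> q \<in> E S" unfolding E_def by blast
      moreover have "x = ((K +>\<^bsub>plane_ring\<^esub> [:[:coef p a b:]:]) \<otimes>\<^bsub>?Q\<^esub> ?v) \<oplus>\<^bsub>?Q\<^esub> (K +>\<^bsub>plane_ring\<^esub> q)"
        unfolding cls_add cls_mult p(2) q_def by simp
      ultimately show "x \<in> Q.line_extension ?C ?v (E S)"
        by (auto simp: Q.line_extension_def set_add_def' r_coset_def)
    qed
    ultimately show ?case using insert by simp
  qed
  have "E D = carrier ?Q"
  proof (intro equalityI subsetI)
    fix x assume "x \<in> carrier ?Q"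
    then obtain p where p: "x = K +>\<^bsub>plane_ring\<^esub> p" by (auto simp: carrier)
    define q where "q = (\<Sum>(a, b)\<in>D. [:[:coef p a b:]:] * (curve ^ a * plane_y ^ b))"
    have q: "coef q a b = (if (a, b) \<in> D then coef p a b else 0)" for a b
    proof -
      have "coef q a b = (\<Sum>m\<in>D. if m = (a, b) then coef p a b else 0)"
        unfolding q_def coef_sum
        by (intro sum.cong) (auto simp: coef_monomial simp del: mult_pCons_left split: if_splits)
      with D show ?thesis by simp
    qed
    have "p - q \<in> K" by (simp add: K_iff q)
    then have "x = K +>\<^bsub>plane_ring\<^esub> q" unfolding p by (simp add: type_ring_coset_eq_iff[OF K])
    then show "x \<in> E D" using q unfolding E_def by (auto intro!: exI[of _ q] split: if_splits)
  qed (auto simp: E_def cls_carrier)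
  with dim[OF D] show ?thesis by (simp add: has_colength_def)
qed

end

section \<open>Powers of the product of curve ideals\<close>

text \<open>The index \<open>m\<close> with the largest exponent is served first. If an \<open>x\<close> is left, it is spent on
  \<open>m\<close>: this removes \<open>w\<^sub>r = min(w\<^sub>r, w\<^sub>m)\<close> from both sides of the inequality for
  \<open>r\<close>. If no \<open>x\<close> is left, the inequality for \<open>m\<close> says that there is enough \<open>y\<close> for all factors.\<close>

lemma monomial_factorization:
  fixes x y :: "'a :: comm_semiring_1" and w :: "'b \<Rightarrow> nat"
  assumes "finite S" and "\<And>r. r \<in> S \<Longrightarrow> (\<Sum>k\<in>S. min (w r) (w k)) \<le> w r * a + b"
  shows "\<exists>z. (\<forall>k\<in>S. z k = x \<or> z k = y ^ w k) \<and> prod z S dvd x ^ a * y ^ b"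
  using assms
proof (induction S arbitrary: a rule: finite_ranking_induct[where f = w])
  case empty
  then show ?case by simp
next
  case (insert m S)
  consider "m \<in> S" | "m \<notin> S" "a = 0" | a' where "m \<notin> S" "a = Suc a'" by (cases a) auto
  then show ?case
  proof cases
    case 1
    then show ?thesis using insert.IH insert.prems by (simp add: insert_absorb)
  next
    case 2
    have "(\<Sum>k\<in>insert m S. w k) = (\<Sum>k\<in>insert m S. min (w m) (w k))"
      using insert.hyps by (intro sum.cong) auto
    also have "\<dots> \<le> b" using insert.prems[of m] 2 by simp
    finally have "y ^ (\<Sum>k\<in>insert m S. w k) dvd x ^ a * y ^ b"
      by (intro dvd_mult le_imp_power_dvd)
    then show ?thesis by (intro exI[of _ "\<lambda>k. y ^ w k"]) (simp add: power_sum)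
  next
    case (3 a')
    have "(\<Sum>k\<in>S. min (w r) (w k)) \<le> w r * a' + b" if r: "r \<in> S" for r
    proof -
      have "min (w r) (w m) = w r" using insert.hyps r by simp
      then show ?thesis using insert.prems[of r] insert.hyps r 3 by simp
    qed
    from insert.IH[OF this] obtain z where z: "\<forall>k\<in>S. z k = x \<or> z k = y ^ w k"
      "prod z S dvd x ^ a' * y ^ b" by blast
    have "prod (z(m := x)) (insert m S) = x * prod z S"
      using insert.hyps 3 by (subst prod.insert) (auto intro!: arg_cong2[where f = "(*)"] prod.cong)
    also have "\<dots> dvd x ^ a * y ^ b"
      using z(2) by (simp add: 3 mult.assoc mult_dvd_mono)
    finally show ?thesis using z(1) by (intro exI[of _ "z(m := x)"]) auto
  qed
qed

locale increasing_exponents = curve_coordinate f for f :: "complex poly" +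
  fixes s :: nat and i :: "nat \<Rightarrow> nat"
  assumes i_pos: "1 \<le> i 1" and i_mono: "strict_mono_on {1..s} i" and f_0: "poly f 0 = 0"
begin

definition factor :: "nat \<Rightarrow> complex poly poly set"
  where "factor k = PIdl\<^bsub>plane_ring\<^esub> curve <+>\<^bsub>plane_ring\<^esub> ideal_power plane_ring origin_ideal (i k)"

abbreviation K :: "complex poly poly set"
  where "K \<equiv> curve_ideal_product f i s"

text \<open>The minimum of the \<open>j\<close>-th valuation on \<open>K\<close>: each factor contributes the smaller of the values \<open>i j\<close>
  of \<open>curve\<close> and \<open>i k\<close> of \<open>y^i\<^sub>k\<close>.\<close>

definition v :: "nat \<Rightarrow> nat"
  where "v j = (\<Sum>k\<in>{1..s}. min (i j) (i k))"

lemma i_less: "j \<in> {1..s} \<Longrightarrow> k \<in> {1..s} \<Longrightarrow> j < k \<Longrightarrow> i j < i k"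
  using i_mono by (simp add: strict_mono_on_def)

lemma i_le: "j \<in> {1..s} \<Longrightarrow> k \<in> {1..s} \<Longrightarrow> j \<le> k \<Longrightarrow> i j \<le> i k"
  using i_less by (metis le_neq_implies_less less_or_eq_imp_le)

lemma i_ge_1: "j \<in> {1..s} \<Longrightarrow> 1 \<le> i j"
  using i_le[of 1 j] i_pos by simp

sublocale base: cring plane_ring by (rule cring_from_type_algebra)

sublocale ideals: comm_monoid "ideals_set plane_ring"
  by (rule base.ideals_set_is_comm_monoid)

lemma origin_ideal: "ideal origin_ideal plane_ring"
  unfolding origin_ideal_def by (rule base.genideal_ideal) simp

sublocale origin: type_ring_ideal origin_ideal
  by (rule type_ring_ideal.intro[OF origin_ideal])

lemma ideal_factor: "ideal (factor k) plane_ring"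
  unfolding factor_def using origin.ideal_pw[unfolded origin.pw_def]
  by (intro base.add_ideals base.cgenideal_ideal) simp_all

lemma curve_in_factor: "curve \<in> factor k"
proof -
  have "curve \<in> PIdl\<^bsub>plane_ring\<^esub> curve" by (rule base.cgenideal_self) simp
  moreover have "0 \<in> ideal_power plane_ring origin_ideal (i k)"
    using ideal_closed(1)[OF origin.ideal_pw] by (simp add: origin.pw_def)
  ultimately show ?thesis unfolding factor_def set_add_def' by force
qed

lemma y_power_in_factor: "plane_y ^ i k \<in> factor k"
proof -
  have y: "plane_y \<in> origin_ideal"
    unfolding origin_ideal_def using base.genideal_self[of "{plane_x, plane_y}"] by simp
  have "plane_y ^ n \<in> origin.pw n" for n
  proof (induction n)
    case (Suc n)
    have "plane_y \<in> origin.pw 1"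
      using y origin_ideal ideals.nat_pow_eone[of origin_ideal]
      by (simp add: origin.pw_def ideals_set_simps)
    with Suc origin.pw_mult[of "plane_y" 1 "plane_y ^ n" n] show ?case by simp
  qed (simp add: origin.pw_0)
  then have "plane_y ^ i k \<in> ideal_power plane_ring origin_ideal (i k)"
    by (simp add: origin.pw_def)
  moreover have "0 \<in> PIdl\<^bsub>plane_ring\<^esub> curve"
    using ideal_closed(1)[OF base.cgenideal_ideal] by simp
  ultimately show ?thesis unfolding factor_def set_add_def' by force
qed

text \<open>Here \<open>f(0) = 0\<close> enters: it gives \<open>x\<close> and hence the whole ideal of the origin positive value.\<close>

lemma factor_subset_F:
  assumes "1 \<le> r"
  shows "factor k \<subseteq> F r (min r (i k))"
proof -
  interpret valuation_filtration "F r" by (rule valuation_filtration_F)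
  have y: "plane_y \<in> F r 1" using monomial_in_F_iff[of 0 1 r 1] by simp
  have curve: "curve \<in> F r r" using monomial_in_F_iff[of 1 0 r r] by simp
  have "[:0, 1:] dvd f" using f_0 by (simp add: poly_eq_0_iff_dvd)
  then obtain g where "f = [:0, 1:] * g" by (elim dvdE)
  then have "[:f:] = [:g:] * plane_y" by (simp add: plane_y_def)
  then have "plane_x = curve - [:g:] * plane_y" by (simp add: curve_def)
  moreover have "curve \<in> F r 1" using F_antimono[OF assms curve] .
  ultimately have "plane_x \<in> F r 1" using y by (metis F_closed(3,4))
  with y have "origin_ideal \<subseteq> F r 1"
    unfolding origin_ideal_def by (intro base.genideal_minimal ideal_F) simp
  then have *: "ideal_power plane_ring origin_ideal (i k) \<subseteq> F r (i k * 1)"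
    by (rule ideal_power_subset)
  have "PIdl\<^bsub>plane_ring\<^esub> curve \<subseteq> F r r"
    by (rule base.cgenideal_minimal[OF ideal_F curve])
  moreover have "F r r \<subseteq> F r (min r (i k))" "F r (i k * 1) \<subseteq> F r (min r (i k))"
    by (auto intro: F_antimono[of "min r (i k)" r] F_antimono[of "min r (i k)" "i k"])
  ultimately have "a \<in> F r (min r (i k))" if "a \<in> PIdl\<^bsub>plane_ring\<^esub> curve" for a
    using that by blast
  moreover have "b \<in> F r (min r (i k))" if "b \<in> ideal_power plane_ring origin_ideal (i k)" for b
    using that * \<open>F r (i k * 1) \<subseteq> F r (min r (i k))\<close> by blast
  ultimately show ?thesis
    unfolding factor_def set_add_def' by (auto intro: F_closed(2))
qed

lemma K_eq: "K = (\<Otimes>\<^bsub>ideals_set plane_ring\<^esub>k\<in>{1..s}. factor k)"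
  by (simp add: curve_ideal_product_def factor_def curve_def)

lemma factor_carrier: "factor \<in> S \<rightarrow> carrier (ideals_set plane_ring)"
  using ideal_factor by (simp add: ideals_set_simps)

lemma ideal_K: "ideal K plane_ring"
  unfolding K_eq using ideals.finprod_closed[OF factor_carrier] by (simp add: ideals_set_simps)

sublocale type_ring_ideal K
  by (rule type_ring_ideal.intro[OF ideal_K])

lemma finprod_factor_insert:
  assumes "finite S" "k \<notin> S"
  shows "(\<Otimes>\<^bsub>ideals_set plane_ring\<^esub>k\<in>insert k S. factor k) =
    factor k \<cdot>\<^bsub>plane_ring\<^esub> (\<Otimes>\<^bsub>ideals_set plane_ring\<^esub>k\<in>S. factor k)"
  using ideals.finprod_insert[OF assms factor_carrier] ideal_factor[of k]
  by (simp add: ideals_set_simps)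

lemma prod_in_finprod_factor:
  assumes "finite S" "\<And>k. k \<in> S \<Longrightarrow> z k \<in> factor k"
  shows "prod z S \<in> (\<Otimes>\<^bsub>ideals_set plane_ring\<^esub>k\<in>S. factor k)"
  using assms
proof (induction S rule: finite_induct)
  case empty
  then show ?case by (simp add: ideals_set_simps)
next
  case (insert k S)
  note finprod_factor_insert[OF insert.hyps]
  with insert ideal_prod.prod[of "z k" "factor k" "prod z S" _ plane_ring] show ?case by simp
qed

lemma finprod_factor_subset_F:
  assumes "finite S" "1 \<le> r"
  shows "(\<Otimes>\<^bsub>ideals_set plane_ring\<^esub>k\<in>S. factor k) \<subseteq> F r (\<Sum>k\<in>S. min r (i k))"
  using assms(1)
proof (induction S rule: finite_induct)
  interpret valuation_filtration "F r" by (rule valuation_filtration_F)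
  case empty
  then show ?case by (simp add: F_0)
next
  interpret valuation_filtration "F r" by (rule valuation_filtration_F)
  case (insert k S)
  note finprod_factor_insert[OF insert.hyps]
  with ideal_prod_subset[OF factor_subset_F[OF assms(2)] insert.IH] insert show ?case by simp
qed

lemma prod_in_power:
  assumes "\<And>t. t < d \<Longrightarrow> g t \<in> K"
  shows "prod g {..<d} \<in> pw d"
  using assms
proof (induction d)
  case 0
  then show ?case by (simp add: pw_0)
next
  case (Suc d)
  have "g d \<in> pw 1"
    using Suc.prems ideal_K ideals.nat_pow_eone[of K] by (simp add: pw_def ideals_set_simps)
  with Suc pw_mult[of "prod g {..<d}" d "g d" 1] show ?case by simp
qed

text \<open>The generators of \<open>K\<^sup>d\<close> are products with one generator for each pair of a copy \<open>t < d\<close> of \<open>K\<close> and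
  a factor \<open>k\<close> of it; the pairs serve as the index set of \<open>monomial_factorization\<close>.\<close>

lemma monomial_in_power:
  assumes "\<And>j. j \<in> {1..s} \<Longrightarrow> d * v j \<le> i j * a + b"
  shows "curve ^ a * plane_y ^ b \<in> pw d"
proof -
  have sum: "(\<Sum>q\<in>{..<d} \<times> {1..s}. min (i (snd p)) (i (snd q))) = d * v (snd p)" for p :: "nat \<times> nat"
  proof -
    have "(\<Sum>q\<in>{..<d} \<times> {1..s}. min (i (snd p)) (i (snd q))) =
        (\<Sum>(t, k)\<in>{..<d} \<times> {1..s}. min (i (snd p)) (i k))"
      by (rule sum.cong) auto
    also have "\<dots> = (\<Sum>t<d. \<Sum>k\<in>{1..s}. min (i (snd p)) (i k))"
      by (rule sum.cartesian_product[symmetric])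
    finally show ?thesis by (simp add: v_def)
  qed
  have "\<exists>z. (\<forall>p\<in>{..<d} \<times> {1..s}. z p = curve \<or> z p = plane_y ^ i (snd p)) \<and>
      prod z ({..<d} \<times> {1..s}) dvd curve ^ a * plane_y ^ b"
  proof (rule monomial_factorization)
    show "(\<Sum>q\<in>{..<d} \<times> {1..s}. min (i (snd p)) (i (snd q))) \<le> i (snd p) * a + b"
      if "p \<in> {..<d} \<times> {1..s}" for p
      unfolding sum using that by (intro assms) auto
  qed simp
  then obtain z where z: "\<forall>p\<in>{..<d} \<times> {1..s}. z p = curve \<or> z p = plane_y ^ i (snd p)"
    and dvd: "prod z ({..<d} \<times> {1..s}) dvd curve ^ a * plane_y ^ b"
    by blast
  have "z (t, k) \<in> factor k" if "t < d" "k \<in> {1..s}" for t k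
    using bspec[OF z, of "(t, k)"] that curve_in_factor[of k] y_power_in_factor[of k] by auto
  then have "(\<Prod>k\<in>{1..s}. z (t, k)) \<in> K" if "t < d" for t
    unfolding K_eq using that by (intro prod_in_finprod_factor) auto
  then have "(\<Prod>t<d. \<Prod>k\<in>{1..s}. z (t, k)) \<in> pw d" by (rule prod_in_power)
  also have "(\<Prod>t<d. \<Prod>k\<in>{1..s}. z (t, k)) = prod z ({..<d} \<times> {1..s})"
    by (simp add: prod.cartesian_product)
  finally show ?thesis using dvd pw_closed(5) by (auto elim!: dvdE)
qed

lemma power_eq_valuations: "pw d = {p. \<forall>j\<in>{1..s}. p \<in> F (i j) (d * v j)}"
proof (intro equalityI subsetI CollectI ballI)
  fix p j assume p: "p \<in> pw d" and j: "j \<in> {1..s}"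
  interpret valuation_filtration "F (i j)" by (rule valuation_filtration_F)
  have "K \<subseteq> F (i j) (v j)"
    unfolding K_eq v_def using finprod_factor_subset_F i_ge_1[OF j] by simp
  from ideal_power_subset[OF this, of d] p show "p \<in> F (i j) (d * v j)" by (auto simp: pw_def)
next
  fix p assume p: "p \<in> {p. \<forall>j\<in>{1..s}. p \<in> F (i j) (d * v j)}"
  show "p \<in> pw d"
  proof (rule polynomial_in_ideal[OF ideal_pw], rule monomial_in_power)
    show "d * v j \<le> i j * a + b" if "coef p a b \<noteq> 0" "j \<in> {1..s}" for a b j
      using that p by (simp add: in_F_iff)
  qed
qed

lemma sum_split_at:
  assumes "j \<in> {1..s}"
  shows "(\<Sum>l\<in>{1..s}. g l) = (\<Sum>l\<in>{1..<j}. g l) + g j + (\<Sum>l\<in>{j<..s}. g l :: nat)"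
proof -
  have "{1..s} = {1..<j} \<union> {j} \<union> {j<..s}" using assms by auto
  also have "sum g \<dots> = sum g {1..<j} + g j + sum g {j<..s}"
    by (subst sum.union_disjoint; (subst sum.union_disjoint)?) auto
  finally show ?thesis .
qed

lemma v_eq:
  assumes j: "j \<in> {1..s}"
  shows "v j = (\<Sum>l\<in>{1..j}. i l) + i j * (s - j)"
proof -
  have "v j = (\<Sum>l\<in>{1..<j}. min (i j) (i l)) + i j + (\<Sum>l\<in>{j<..s}. min (i j) (i l))"
    unfolding v_def by (subst sum_split_at[OF j]) simp
  also have "(\<Sum>l\<in>{1..<j}. min (i j) (i l)) = (\<Sum>l\<in>{1..<j}. i l)"
    using j by (intro sum.cong refl min_absorb2 i_le) auto
  also have "(\<Sum>l\<in>{j<..s}. min (i j) (i l)) = (\<Sum>l\<in>{j<..s}. i j)"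
    using j by (intro sum.cong refl min_absorb1 i_le) auto
  also have "(\<Sum>l\<in>{1..<j}. i l) + i j = (\<Sum>l\<in>{1..j}. i l)"
    using j by (cases j) (auto simp: atLeastLessThanSuc_atLeastAtMost)
  finally show ?thesis by (simp add: mult.commute)
qed

text \<open>Up to the missing factor \<open>y\<close>, the product of the two ends of the \<open>j\<close>-th edge of the Newton polygon.\<close>

definition separator :: "nat \<Rightarrow> complex poly poly"
  where "separator j = curve ^ (2 * (s - j) + 1) * plane_y ^ (2 * (\<Sum>l\<in>{1..<j}. i l) + i j - 1)"

lemma separator_mult_y:
  assumes "j \<in> {1..s}"
  shows "separator j * plane_y = curve ^ (2 * (s - j) + 1) * plane_y ^ (2 * (\<Sum>l\<in>{1..<j}. i l) + i j)"
proof -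
  have "2 * (\<Sum>l\<in>{1..<j}. i l) + i j = Suc (2 * (\<Sum>l\<in>{1..<j}. i l) + i j - 1)"
    using i_ge_1[OF assms] by simp
  then show ?thesis by (metis separator_def mult.assoc power_Suc2)
qed

text \<open>The value of the \<open>j\<close>-th edge product under a slope \<open>i k\<close> exceeds \<open>2 v k\<close> by nonnegative terms, one of
  which is \<open>\<bar>i k - i j\<bar>\<close>; all of them vanish for \<open>k = j\<close>.\<close>

lemma separator_weight:
  assumes j: "j \<in> {1..s}" and k: "k \<in> {1..s}"
  shows "2 * v j = i j * (2 * (s - j) + 1) + (2 * (\<Sum>l\<in>{1..<j}. i l) + i j)" (is ?self)
    and "k \<noteq> j \<Longrightarrow> 2 * v k < i k * (2 * (s - j) + 1) + (2 * (\<Sum>l\<in>{1..<j}. i l) + i j)"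
proof -
  have "(\<Sum>l\<in>{1..j}. i l) = (\<Sum>l\<in>{1..<j}. i l) + i j"
    using j by (cases j) (auto simp: atLeastLessThanSuc_atLeastAtMost)
  then show ?self by (simp add: v_eq[OF j] algebra_simps)
  assume "k \<noteq> j"
  then have "i k \<noteq> i j" using i_less[of j k] i_less[of k j] j k by (cases j k rule: linorder_cases) auto
  then have "2 * min (i k) (i j) < i k + i j" by auto
  moreover have "(\<Sum>l\<in>{1..<j}. min (i k) (i l)) \<le> (\<Sum>l\<in>{1..<j}. i l)"
    by (intro sum_mono) simp
  moreover have "(\<Sum>l\<in>{j<..s}. min (i k) (i l)) \<le> (\<Sum>l\<in>{j<..s}. i k)"
    by (intro sum_mono) simp
  moreover have "(\<Sum>l\<in>{j<..s}. i k) = i k * (s - j)" by simp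
  moreover have "v k = (\<Sum>l\<in>{1..<j}. min (i k) (i l)) + min (i k) (i j) + (\<Sum>l\<in>{j<..s}. min (i k) (i l))"
    unfolding v_def by (rule sum_split_at[OF j])
  moreover have "i k * (2 * (s - j) + 1) = 2 * (i k * (s - j)) + i k" by (simp add: algebra_simps)
  ultimately show "2 * v k < i k * (2 * (s - j) + 1) + (2 * (\<Sum>l\<in>{1..<j}. i l) + i j)"
    by linarith
qed

lemma behrend_number_K: "behrend_number plane_ring K = enat (\<Sum>j\<in>{1..s}. v j)"
proof -
  have "valuation_ideal K {1..s} (\<lambda>j. F (i j)) v plane_y (\<lambda>j. 2) separator"
  proof (intro valuation_ideal.intro valuation_ideal_axioms.intro)
    show "type_ring_ideal K" by (rule type_ring_ideal_axioms)
    show "finite {1..s}" by simp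
    fix j assume j: "j \<in> {1..s}"
    have "i j \<le> (\<Sum>l\<in>{1..j}. i l)" using j by (intro member_le_sum) auto
    then have "i j \<le> v j" by (simp add: v_eq[OF j])
    with i_ge_1[OF j] show "0 < v j" by simp
    show "valuation_filtration (F (i j))" by (rule valuation_filtration_F)
    show "plane_y \<in> F (i j) 1" "plane_y \<notin> F (i j) 2"
      using monomial_in_F_iff[of 0 1 "i j"] by simp_all
    show "separator j * plane_y \<in> F (i j) (2 * v j)" "separator j * plane_y \<notin> F (i j) (Suc (2 * v j))"
      unfolding separator_mult_y[OF j] monomial_in_F_iff using separator_weight(1)[OF j j] by linarith+
    show "separator j * plane_y \<in> F (i k) (Suc (2 * v k))" if "k \<in> {1..s}" "k \<noteq> j" for k
      unfolding separator_mult_y[OF j] monomial_in_F_iff using separator_weight(2)[OF j that] by linarith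
  next
    show "ideal_power plane_ring K d = {p. \<forall>j\<in>{1..s}. p \<in> F (i j) (d * v j)}" for d
      using power_eq_valuations[of d] by (simp add: pw_def)
  qed
  then show ?thesis by (rule valuation_ideal.behrend_number_valuation_ideal)
qed

text \<open>In column \<open>a < s\<close> the sharpest of the inequalities is that of the edge \<open>j = s - a\<close>, which
  ends in that column. It implies the others because \<open>min(i j, i l)\<close> is at most \<open>i l\<close> for
  \<open>l \<le> s - a\<close> and at most \<open>i j\<close> for the \<open>a\<close> remaining \<open>l\<close>.\<close>

lemma outside_staircase_iff:
  "(\<forall>j\<in>{1..s}. v j \<le> i j * a + b) \<longleftrightarrow> \<not> (a < s \<and> b < (\<Sum>l\<in>{1..s - a}. i l))"
proof
  assume all: "\<forall>j\<in>{1..s}. v j \<le> i j * a + b"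
  show "\<not> (a < s \<and> b < (\<Sum>l\<in>{1..s - a}. i l))"
  proof
    assume ab: "a < s \<and> b < (\<Sum>l\<in>{1..s - a}. i l)"
    then have j: "s - a \<in> {1..s}" by auto
    have "v (s - a) = (\<Sum>l\<in>{1..s - a}. i l) + i (s - a) * a"
      using v_eq[OF j] ab by simp
    with bspec[OF all j] ab show False by linarith
  qed
next
  assume out: "\<not> (a < s \<and> b < (\<Sum>l\<in>{1..s - a}. i l))"
  show "\<forall>j\<in>{1..s}. v j \<le> i j * a + b"
  proof
    fix j assume j: "j \<in> {1..s}"
    have "{1..s} = {1..s - a} \<union> {s - a<..s}" by auto
    then have "v j = (\<Sum>l\<in>{1..s - a}. min (i j) (i l)) + (\<Sum>l\<in>{s - a<..s}. min (i j) (i l))"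
      unfolding v_def by (subst sum.union_disjoint[symmetric]) auto
    also have "(\<Sum>l\<in>{1..s - a}. min (i j) (i l)) \<le> (\<Sum>l\<in>{1..s - a}. i l)"
      by (intro sum_mono) simp
    also have "(\<Sum>l\<in>{1..s - a}. i l) \<le> b"
      using out by (cases "a < s") auto
    also have "(\<Sum>l\<in>{s - a<..s}. min (i j) (i l)) \<le> (\<Sum>l\<in>{s - a<..s}. i j)"
      by (intro sum_mono) simp
    also have "(\<Sum>l\<in>{s - a<..s}. i j) = i j * (s - (s - a))" by simp
    also have "\<dots> \<le> i j * a" by (intro mult_le_mono2) simp
    finally show "v j \<le> i j * a + b" by simp
  qed
qed

lemma has_colength_K: "has_colength K (\<Sum>k=1..s. \<Sum>j=1..k. i j)"
proof -
  define D where "D = (SIGMA a:{..<s}. {..<\<Sum>l\<in>{1..s - a}. i l})"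
  have "p \<in> K \<longleftrightarrow> (\<forall>a b. coef p a b \<noteq> 0 \<longrightarrow> (a, b) \<notin> D)" for p
  proof -
    have "K = pw 1" using ideal_K ideals.nat_pow_eone[of K] by (simp add: pw_def ideals_set_simps)
    then have "p \<in> K \<longleftrightarrow> (\<forall>j\<in>{1..s}. p \<in> F (i j) (v j))" using power_eq_valuations[of 1] by simp
    also have "\<dots> \<longleftrightarrow> (\<forall>a b. coef p a b \<noteq> 0 \<longrightarrow> (\<forall>j\<in>{1..s}. v j \<le> i j * a + b))"
      unfolding in_F_iff by blast
    finally show ?thesis unfolding outside_staircase_iff D_def by simp
  qed
  then have "has_colength K (card D)"
    by (intro has_colength_monomial_ideal ideal_K) (simp add: D_def)
  also have "card D = (\<Sum>a<s. \<Sum>l\<in>{1..s - a}. i l)" by (simp add: D_def)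
  also have "\<dots> = (\<Sum>k=1..s. \<Sum>j=1..k. i j)"
    by (rule sum.reindex_bij_witness[of _ "\<lambda>k. s - k" "\<lambda>a. s - a"]) auto
  finally show ?thesis .
qed

end

section \<open>Closed forms\<close>

lemma sum_triangular_numbers:
  fixes s :: nat
  shows "(\<Sum>k=1..s. \<Sum>j=1..k. j) = (s + 2) choose 3"
proof (induction s)
  case (Suc s)
  have "(\<Sum>j=1..n. j) = Suc n choose 2" for n :: nat
    by (induction n) (simp_all add: numeral_2_eq_2)
  from this[of "Suc s"] have "(\<Sum>j=1..Suc s. j) = (s + 2) choose 2"
    by simp
  with Suc show ?case by (simp add: numeral_3_eq_3 numeral_2_eq_2)
qed (simp add: numeral_3_eq_3)

lemma sum_squares_formula:
  fixes s :: nat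
  assumes "s \<ge> 1"
  shows "(\<Sum>k=1..s. \<Sum>j=1..k. j) + (\<Sum>j=1..s - 1. j * (s - j)) = s * (s + 1) * (2 * s + 1) div 6"
proof -
  have "(\<Sum>j=1..n. j * (Suc n - j)) = (\<Sum>k=1..n. \<Sum>j=1..k. j)" for n :: nat
  proof (induction n)
    case (Suc n)
    have "(\<Sum>j=1..Suc n. j * (Suc (Suc n) - j)) = (\<Sum>j=1..Suc n. j * (Suc n - j) + j)"
      by (intro sum.cong) (auto simp: Suc_diff_le)
    also have "\<dots> = (\<Sum>j=1..n. j * (Suc n - j)) + (\<Sum>j=1..Suc n. j)"
      by (simp add: sum.distrib)
    finally show ?case using Suc by simp
  qed simp
  moreover obtain n where s: "s = Suc n" using assms by (cases s) auto
  moreover have "6 * ((\<Sum>k=1..Suc n. \<Sum>j=1..k. j) + (\<Sum>k=1..n. \<Sum>j=1..k. j)) =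
      Suc n * (Suc n + 1) * (2 * Suc n + 1)"
  proof (induction n)
    case (Suc n)
    have "2 * (\<Sum>j=1..m. j) = m * (m + 1)" for m :: nat by (induction m) auto
    from this[of "Suc n"] this[of "Suc (Suc n)"] Suc show ?case by (simp add: algebra_simps)
  qed simp
  ultimately show ?thesis by simp
qed

theorem theorem1:
  fixes s :: nat and i :: "nat \<Rightarrow> nat" and f :: "complex poly"
  assumes "s \<ge> 1"
    and "i 1 \<ge> 1"
    and "strict_mono_on {1..s} i"
    and "poly f 0 = 0"
    and "degree f < i s"
  shows "has_colength (curve_ideal_product f i s) (\<Sum>k=1..s. \<Sum>j=1..k. i j) \<and>
    behrend_number plane_ring (curve_ideal_product f i s) =
      enat ((\<Sum>k=1..s. \<Sum>j=1..k. i j) + (\<Sum>j=1..s-1. i j * (s - j))) \<and>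
    ((\<forall>k\<in>{1..s}. i k = k) \<longrightarrow>
      has_colength (curve_ideal_product f (\<lambda>k. k) s) ((s + 2) choose 3) \<and>
      behrend_number plane_ring (curve_ideal_product f (\<lambda>k. k) s) =
        enat (s * (s + 1) * (2 * s + 1) div 6))"
proof -
  have general: "has_colength (curve_ideal_product f e s) (\<Sum>k=1..s. \<Sum>j=1..k. e j) \<and>
      behrend_number plane_ring (curve_ideal_product f e s) =
        enat ((\<Sum>k=1..s. \<Sum>j=1..k. e j) + (\<Sum>j=1..s-1. e j * (s - j)))"
    if "1 \<le> e 1" "strict_mono_on {1..s} e" for e
  proof -
    interpret increasing_exponents f s e by standard (use that assms in auto)
    have "(\<Sum>j\<in>{1..s}. v j) = (\<Sum>k=1..s. \<Sum>j=1..k. e j) + (\<Sum>j=1..s. e j * (s - j))"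
      by (simp add: v_eq sum.distrib)
    also have "(\<Sum>j=1..s. e j * (s - j)) = (\<Sum>j=1..s-1. e j * (s - j))"
      using assms(1) by (cases s) auto
    finally show ?thesis using has_colength_K behrend_number_K by simp
  qed
  have "strict_mono_on {1..s} (\<lambda>k. k)" by (simp add: strict_mono_on_def)
  note staircase = general[OF order_refl this, unfolded sum_squares_formula[OF assms(1)]]
  from general[OF assms(2,3)] staircase show ?thesis
    unfolding sum_triangular_numbers by blast
qed

end
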